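(* For any field $F$, $$\overline{\mathcal{RP}}_1(F)[\tfrac12]=\mathrm e^+_{-1}\,\overline{\mathcal{RP}}(F)[\tfrac12]$$ as submodules of $\overline{\mathcal{RP}}(F)[\tfrac12]$, where $\mathrm e^+_{-1}=\frac{1+\langle-1\rangle}{2}$.
   Context: For an abelian group $A$, $A[\frac12]=A\otimes\mathbb Z[\frac12]$. For a field $F$, $R_F=\mathbb Z[F^\times/(F^\times)^2]$; $\langle x\rangle\in R_F$ is the square class of $x\in F^\times$; $\langle\!\langle x\rangle\!\rangle=\langle x\rangle-1$; $\mathcal I_F\subset R_F$ is the augmentation ideal. $\mathrm e^+_{-1}$ is an idempotent of $R_F[\frac12]$. Refined scissors congruence groups. If $F$ has at least $4$ elements, $\mathcal{RP}(F)$ is the $R_F$-module with generators $[x]$, $x\in F^\times$, and relations $[1]=0$ and, for all $x,y\in F^\times\setminus\{1\}$, $$0=[x]-[y]+\langle x\rangle\left[\tfrac yx\right]-\langle x^{-1}-1\rangle\left[\tfrac{1-x^{-1}}{1-y^{-1}}\right]+\langle 1-x\rangle\left[\tfrac{1-x}{1-y}\right].$$ $\lambda_1:\mathcal{RP}(F)\to\mathcal I_F^2$ is the (well-defined) $R_F$-homomorphism with $[x]\mapsto\langle\!\langle 1-x\rangle\!\rangle\langle\!\langle x\rangle\!\rangle$ for $x\neq1$. Put $\psi_1(x)=[x]+\langle-1\rangle[x^{-1}]$ and let $\mathcal K^{(1)}_F$ be the $R_F$-submodule generated by all $\psi_1(x)$, $x\in F^\times$. The element $C_F=[x]+\langle-1\rangle[1-x]+\langle\!\langle1-x\rangle\!\rangle\psi_1(x)$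 ($x\ne0,1$) is independent of $x$ and $6C_F=0$. Small fields: $\mathcal{RP}(\mathbb F_2)$ is a group of order $3$ with distinguished generator $C_{\mathbb F_2}$ (with $\lambda_1=0$, $\mathcal K^{(1)}_{\mathbb F_2}=0$). $\mathcal{RP}(\mathbb F_3)$ is the cyclic $R_{\mathbb F_3}$-module generated by $[-1]$ with the single relation $2([-1]+\langle-1\rangle[-1])=0$ (and $[1]=0$), $\lambda_1([-1])=\langle\!\langle-1\rangle\!\rangle^2$, $C_{\mathbb F_3}=\psi_1(-1)=(1+\langle-1\rangle)[-1]$. For every field $F$: $D_F=2C_F$, $\mathcal D_F=R_F D_F$ (annihilated by $3$). $\widetilde{\mathcal{RP}}(F)=\mathcal{RP}(F)/\mathcal K^{(1)}_F$; $\widetilde{\mathcal{RP}}_1(F)$ is the kernel of the map $\widetilde{\mathcal{RP}}(F)\to\mathcal I_F^2/(1+\langle-1\rangle)\mathcal I_F$ induced by $\lambda_1$. The map $\mathcal D_F\to\widetilde{\mathcal{RP}}(F)$ is injective with image in $\widetilde{\mathcal{RP}}_1(F)$, and one sets $\overline{\mathcal{RP}}(F)=\widetilde{\mathcal{RP}}(F)/\mathcal D_F$, $\overline{\mathcal{RP}}_1(F)=\widetilde{\mathcal{RP}}_1(F)/\mathcal D_F$. *)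

theory Defs
  imports Complex_Main "HOL-Library.Poly_Mapping" "HOL-Library.Cardinality"
begin

section \<open>Free modules and abelian groups as \<open>\<int>\<close>-modules\<close>

lifting_forget poly_mapping.lifting

lemma poly_mapping_add_induct [case_names single sum]:
  assumes "\<And>k n. P (Poly_Mapping.single k n)" and "\<And>f g. P f \<Longrightarrow> P g \<Longrightarrow> P (f + g)"
  shows "P (f :: 'b \<Rightarrow>\<^sub>0 'r::comm_monoid_add)"
proof -
  have "P 0" using assms(1)[of undefined 0] by simp
  then have "P (\<Sum>k\<in>A. Poly_Mapping.single k (Poly_Mapping.lookup f k))" for A
    by (induction A rule: infinite_finite_induct) (auto intro: assms)
  moreover have "(\<Sum>k\<in>Poly_Mapping.keys f. Poly_Mapping.single k (Poly_Mapping.lookup f k)) = f"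
    by (rule poly_mapping_eqI)
      (auto simp: lookup_sum lookup_single when_def sum.delta' in_keys_iff)
  ultimately show ?thesis by metis
qed

text \<open>The free \<open>'r\<close>-module on \<open>'b\<close> is the type \<open>'b \<Rightarrow>\<^sub>0 'r\<close>.\<close>

definition free_scale :: "'r::comm_ring_1 \<Rightarrow> ('b \<Rightarrow>\<^sub>0 'r) \<Rightarrow> ('b \<Rightarrow>\<^sub>0 'r)"
  where "free_scale r f = Poly_Mapping.map ((*) r) f"

lemma lookup_free_scale [simp]:
  "Poly_Mapping.lookup (free_scale r f) k = r * Poly_Mapping.lookup f k"
  by (simp add: free_scale_def Poly_Mapping.map.rep_eq when_def)

interpretation free: module free_scale
  by standard (auto intro!: poly_mapping_eqI simp: lookup_add algebra_simps)

definition free_lift ::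
    "('r::comm_ring_1 \<Rightarrow> 'm::ab_group_add \<Rightarrow> 'm) \<Rightarrow> ('b \<Rightarrow> 'm) \<Rightarrow> ('b \<Rightarrow>\<^sub>0 'r) \<Rightarrow> 'm"
  where "free_lift s g f =
    (\<Sum>k\<in>Poly_Mapping.keys f. s (Poly_Mapping.lookup f k) (g k))"

context module
begin

lemma free_lift_superset:
  assumes "finite A" "Poly_Mapping.keys f \<subseteq> A"
  shows "free_lift scale g f = (\<Sum>k\<in>A. Poly_Mapping.lookup f k *s g k)"
  unfolding free_lift_def
  by (rule sum.mono_neutral_left) (use assms in \<open>auto simp: in_keys_iff\<close>)

lemma module_hom_free_lift: "module_hom free_scale scale (free_lift scale g)"
proof (unfold_locales)
  fix f f' :: "'c \<Rightarrow>\<^sub>0 'a" and r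
  let ?A = "Poly_Mapping.keys f \<union> Poly_Mapping.keys f'"
  have fin: "finite ?A" by simp
  have sub: "Poly_Mapping.keys (f + f') \<subseteq> ?A" by (rule Poly_Mapping.keys_add)
  show "free_lift scale g (f + f') = free_lift scale g f + free_lift scale g f'"
    by (simp add: free_lift_superset[OF fin sub] free_lift_superset[OF fin, of f]
        free_lift_superset[OF fin, of f'] lookup_add scale_left_distrib sum.distrib)
  have sub2: "Poly_Mapping.keys (free_scale r f) \<subseteq> Poly_Mapping.keys f"
    by (auto simp: in_keys_iff)
  show "free_lift scale g (free_scale r f) = r *s free_lift scale g f"
    by (subst free_lift_superset[OF _ sub2]) (simp_all add: free_lift_def scale_sum_right)
qed

lemma free_lift_add: "free_lift scale g (x + y) = free_lift scale g x + free_lift scale g y"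
  and free_lift_diff: "free_lift scale g (x - y) = free_lift scale g x - free_lift scale g y"
  and free_lift_scale: "free_lift scale g (free_scale r x) = r *s free_lift scale g x"
  using module_hom.add[OF module_hom_free_lift] module_hom.diff[OF module_hom_free_lift]
    module_hom.scale[OF module_hom_free_lift] by blast+

lemma free_lift_single: "free_lift scale g (Poly_Mapping.single k r) = r *s g k"
  by (simp add: free_lift_superset[of "{k}"])

lemma free_lift_span_0:
  assumes "\<And>f. f \<in> S \<Longrightarrow> free_lift scale g f = 0" and "f \<in> free.span S"
  shows "free_lift scale g f = 0"
proof -
  interpret h: module_hom free_scale scale "free_lift scale g"
    by (rule module_hom_free_lift)
  have "free.span S \<subseteq> {f. free_lift scale g f = 0}"
    by (rule free.span_minimal) (use assms in \<open>auto simp: free.subspace_def h.add h.scale\<close>)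
  with assms(2) show ?thesis by auto
qed

lemma equivp_subspace:
  assumes "subspace S" shows "equivp (\<lambda>x y. x - y \<in> S)"
proof (rule equivpI)
  show "reflp (\<lambda>x y. x - y \<in> S)"
    using assms by (auto simp: reflp_def subspace_def)
  show "symp (\<lambda>x y. x - y \<in> S)"
    by (rule sympI) (use subspace_neg[OF assms] in force)
  show "transp (\<lambda>x y. x - y \<in> S)"
    by (rule transpI) (use subspace_add[OF assms] in force)
qed

lemma subspace_add_cong:
  "\<lbrakk>subspace S; x - x' \<in> S; y - y' \<in> S\<rbrakk> \<Longrightarrow> (x + y) - (x' + y') \<in> S"
  using subspace_add[of S "x - x'" "y - y'"] by (simp add: algebra_simps)

lemma subspace_diff_cong:
  "\<lbrakk>subspace S; x - x' \<in> S; y - y' \<in> S\<rbrakk> \<Longrightarrow> (x - y) - (x' - y') \<in> S"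
  using subspace_diff[of S "x - x'" "y - y'"] by (simp add: algebra_simps)

lemma subspace_uminus_cong:
  "\<lbrakk>subspace S; x - x' \<in> S\<rbrakk> \<Longrightarrow> (- x) - (- x') \<in> S"
  using subspace_neg[of S "x - x'"] by (simp add: algebra_simps)

lemma subspace_scale_cong:
  "\<lbrakk>subspace S; x - x' \<in> S\<rbrakk> \<Longrightarrow> (r *s x) - (r *s x') \<in> S"
  using subspace_scale[of S "x - x'" r] by (simp add: algebra_simps)

end

definition zscale :: "int \<Rightarrow> 'm::ab_group_add \<Rightarrow> 'm"
  where "zscale n x = (\<Sum>i<nat n. x) - (\<Sum>i<nat (- n). x)"

interpretation zmod: module zscale
proof
  have nadd: "(\<Sum>i<m + n. x) = (\<Sum>i<m. x) + (\<Sum>i<n. x)" for m n :: nat and x :: "'m::ab_group_add"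
    by (induction n) (auto simp: algebra_simps)
  show add: "zscale (a + b) x = zscale a x + zscale b x" for a b and x :: "'m::ab_group_add"
  proof -
    have "nat (a + b) + nat (- a) + nat (- b) = nat a + nat b + nat (- (a + b))"
      by linarith
    then have "(\<Sum>i<nat (a + b) + nat (- a) + nat (- b). x)
        = (\<Sum>i<nat a + nat b + nat (- (a + b)). x)" by presburger
    then show ?thesis by (simp add: zscale_def nadd algebra_simps)
  qed
  show one: "zscale 1 x = x" for x :: "'m::ab_group_add"
    by (simp add: zscale_def)
  show "zscale a (x + y) = zscale a x + zscale a y" for a and x y :: "'m::ab_group_add"
    by (simp add: zscale_def sum.distrib)
  have neg: "zscale (- a) x = - zscale a x" for a and x :: "'m::ab_group_add"
    by (simp add: zscale_def)
  have sub: "zscale (a - b) x = zscale a x - zscale b x" for a b and x :: "'m::ab_group_add"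
    using add[of a "- b" x] by (simp add: neg)
  show "zscale a (zscale b x) = zscale (a * b) x" for a b and x :: "'m::ab_group_add"
  proof (induction a rule: int_induct[where k = 0])
    case base then show ?case by (simp add: zscale_def)
  next
    case (step1 i) then show ?case by (simp add: distrib_right add one)
  next
    case (step2 i) then show ?case by (simp add: left_diff_distrib sub one)
  qed
qed

lemma additive_zscale: "additive f \<Longrightarrow> f (zscale n x) = zscale n (f x)"
  by (simp add: zscale_def additive.diff additive.sum)


section \<open>Tensor products of abelian groups\<close>

definition bilinear_rels ::
    "('a::ab_group_add \<times> 'b::ab_group_add \<Rightarrow>\<^sub>0 int) set"
  where "bilinear_rels =
    (\<Union>a a' b. {Poly_Mapping.single (a + a', b) 1
        - Poly_Mapping.single (a, b) 1 - Poly_Mapping.single (a', b) 1}) \<union>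
    (\<Union>a b b'. {Poly_Mapping.single (a, b + b') 1
        - Poly_Mapping.single (a, b) 1 - Poly_Mapping.single (a, b') 1})"

definition tensor_rel ::
    "('a::ab_group_add \<times> 'b::ab_group_add \<Rightarrow>\<^sub>0 int) \<Rightarrow> ('a \<times> 'b \<Rightarrow>\<^sub>0 int) \<Rightarrow> bool"
  where "tensor_rel f g \<longleftrightarrow> f - g \<in> free.span bilinear_rels"

quotient_type (overloaded) ('a, 'b) tensor =
    "('a::ab_group_add \<times> 'b::ab_group_add) \<Rightarrow>\<^sub>0 int" / tensor_rel
  unfolding tensor_rel_def by (rule free.equivp_subspace) simp

instantiation tensor :: (ab_group_add, ab_group_add) ab_group_add
begin
lift_definition zero_tensor :: "('a, 'b) tensor" is 0 .
lift_definition plus_tensor :: "('a, 'b) tensor \<Rightarrow> ('a, 'b) tensor \<Rightarrow> ('a, 'b) tensor"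
  is "(+)" unfolding tensor_rel_def by (rule free.subspace_add_cong) auto
lift_definition minus_tensor :: "('a, 'b) tensor \<Rightarrow> ('a, 'b) tensor \<Rightarrow> ('a, 'b) tensor"
  is "(-)" unfolding tensor_rel_def by (rule free.subspace_diff_cong) auto
lift_definition uminus_tensor :: "('a, 'b) tensor \<Rightarrow> ('a, 'b) tensor"
  is uminus unfolding tensor_rel_def by (rule free.subspace_uminus_cong) auto
instance
  by standard (transfer; simp add: tensor_rel_def free.span_zero algebra_simps)+
end

lift_definition tens :: "'a::ab_group_add \<Rightarrow> 'b::ab_group_add \<Rightarrow> ('a, 'b) tensor"
    (infixl "\<otimes>\<^sub>\<int>" 70)
  is "\<lambda>a b. Poly_Mapping.single (a, b) 1" .

lemma tens_add_left: "(a + a') \<otimes>\<^sub>\<int> b = a \<otimes>\<^sub>\<int> b + a' \<otimes>\<^sub>\<int> b"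
  by transfer (unfold tensor_rel_def diff_diff_eq[symmetric],
      rule free.span_base, force simp: bilinear_rels_def)

lemma tens_add_right: "a \<otimes>\<^sub>\<int> (b + b') = a \<otimes>\<^sub>\<int> b + a \<otimes>\<^sub>\<int> b'"
  by transfer (unfold tensor_rel_def diff_diff_eq[symmetric],
      rule free.span_base, force simp: bilinear_rels_def)

text \<open>The homomorphism out of the tensor product induced by \<open>f\<close>; only meaningful if
  \<open>f\<close> is additive in each argument, see \<open>tensor_lift_tens\<close> and \<open>tensor_lift_add\<close>.\<close>

definition tensor_lift ::
    "('a::ab_group_add \<Rightarrow> 'b::ab_group_add \<Rightarrow> 'c::ab_group_add) \<Rightarrow> ('a, 'b) tensor \<Rightarrow> 'c"
  where "tensor_lift f t = free_lift zscale (\<lambda>(a, b). f a b) (rep_tensor t)"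

locale biadditive =
  fixes f :: "'a::ab_group_add \<Rightarrow> 'b::ab_group_add \<Rightarrow> 'c::ab_group_add"
  assumes add_left: "f (a + a') b = f a b + f a' b"
    and add_right: "f a (b + b') = f a b + f a b'"
begin

lemma free_lift_cong:
  assumes "tensor_rel x y"
  shows "free_lift zscale (\<lambda>(a, b). f a b) x = free_lift zscale (\<lambda>(a, b). f a b) y"
proof -
  have "free_lift zscale (\<lambda>(a, b). f a b) (x - y) = 0"
    by (rule zmod.free_lift_span_0[of bilinear_rels])
      (use assms in \<open>auto simp: tensor_rel_def bilinear_rels_def zmod.free_lift_diff
        zmod.free_lift_single add_left add_right\<close>)
  then show ?thesis by (simp add: zmod.free_lift_diff)
qed

lemma tensor_lift_abs:
  "tensor_lift f (abs_tensor x) = free_lift zscale (\<lambda>(a, b). f a b) x"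
  unfolding tensor_lift_def
  by (rule free_lift_cong) (simp add: Quotient3_abs_rep[OF Quotient3_tensor]
      Quotient3_rel_rep[OF Quotient3_tensor] tensor.abs_eq_iff[symmetric]
      rep_abs_rsp_left[OF Quotient3_tensor] tensor_rel_def free.span_zero)

lemma tensor_lift_tens: "tensor_lift f (a \<otimes>\<^sub>\<int> b) = f a b"
  by (simp add: tens.abs_eq tensor_lift_abs zmod.free_lift_single)

lemma additive_tensor_lift: "additive (tensor_lift f)"
proof
  fix x y :: "('a, 'b) tensor"
  show "tensor_lift f (x + y) = tensor_lift f x + tensor_lift f y"
    by (induct x rule: tensor.abs_induct; induct y rule: tensor.abs_induct)
      (simp add: plus_tensor.abs_eq tensor_lift_abs zmod.free_lift_add)
qed

lemmas tensor_lift_add = additive.add[OF additive_tensor_lift]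

end

definition tensor_map ::
    "('a::ab_group_add \<Rightarrow> 'c::ab_group_add) \<Rightarrow> ('b::ab_group_add \<Rightarrow> 'd::ab_group_add)
      \<Rightarrow> ('a, 'b) tensor \<Rightarrow> ('c, 'd) tensor"
  where "tensor_map f g = tensor_lift (\<lambda>a b. f a \<otimes>\<^sub>\<int> g b)"

text \<open>The action of \<open>R \<otimes> Z\<close> on \<open>M \<otimes> Z\<close>, given by
  \<open>(r \<otimes> p) \<cdot> (m \<otimes> q) = s r m \<otimes> p q\<close>, for an action \<open>s\<close> of \<open>R\<close> on \<open>M\<close> and a
  commutative ring \<open>Z\<close>.\<close>

definition tensor_act ::
    "('r::comm_ring_1 \<Rightarrow> 'm::ab_group_add \<Rightarrow> 'm) \<Rightarrow> ('r, 'z::comm_ring_1) tensor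
      \<Rightarrow> ('m, 'z) tensor \<Rightarrow> ('m, 'z) tensor"
  where "tensor_act s t u =
    tensor_lift (\<lambda>r p. tensor_lift (\<lambda>m q. s r m \<otimes>\<^sub>\<int> (p * q)) u) t"

lemma biadditive_tensor_map:
  assumes "additive f" "additive g"
  shows "biadditive (\<lambda>a b. f a \<otimes>\<^sub>\<int> g b)"
  using assms by unfold_locales (simp_all add: additive.add tens_add_left tens_add_right)

lemma tensor_map_tens:
  assumes "additive f" "additive g"
  shows "tensor_map f g (a \<otimes>\<^sub>\<int> b) = f a \<otimes>\<^sub>\<int> g b"
  unfolding tensor_map_def by (rule biadditive.tensor_lift_tens[OF biadditive_tensor_map[OF assms]])

lemma additive_tensor_map:
  assumes "additive f" "additive g"
  shows "additive (tensor_map f g)"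
  unfolding tensor_map_def by (rule biadditive.additive_tensor_lift[OF biadditive_tensor_map[OF assms]])

lemma tensor_induct [case_names tens add]:
  assumes "\<And>a b. P (a \<otimes>\<^sub>\<int> b)" and "\<And>t u. P t \<Longrightarrow> P u \<Longrightarrow> P (t + u)"
  shows "P (t :: ('a::ab_group_add, 'b::ab_group_add) tensor)"
proof -
  interpret l: biadditive "tens :: 'a \<Rightarrow> 'b \<Rightarrow> _"
    by unfold_locales (simp_all add: tens_add_left tens_add_right)
  have zero: "tens 0 b = (0 :: ('a, 'b) tensor)" for b
    using tens_add_left[of 0 0 b] by simp
  have neg: "- (a \<otimes>\<^sub>\<int> b) = (- a) \<otimes>\<^sub>\<int> b" for a :: 'a and b :: 'b
    using tens_add_left[of a "- a" b] by (simp add: zero add_eq_0_iff)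
  have nmul: "(\<Sum>i<n. a \<otimes>\<^sub>\<int> b) = (\<Sum>i<n. a) \<otimes>\<^sub>\<int> b" for n :: nat and a :: 'a and b :: 'b
    by (induction n) (simp_all add: zero tens_add_left)
  have zs: "zscale n (a \<otimes>\<^sub>\<int> b) = zscale n a \<otimes>\<^sub>\<int> b" for n and a :: 'a and b :: 'b
    unfolding zscale_def nmul by (simp only: diff_conv_add_uminus neg tens_add_left)
  have main: "P (abs_tensor f)" for f :: "'a \<times> 'b \<Rightarrow>\<^sub>0 int"
  proof (induction f rule: poly_mapping_add_induct)
    case (single k n)
    obtain a b where k: "k = (a, b)" by fastforce
    have "Poly_Mapping.single k n = free_scale n (Poly_Mapping.single k 1)"
      by (rule poly_mapping_eqI) (simp add: lookup_single when_def)
    moreover have "abs_tensor (free_scale n f) = zscale n (abs_tensor f)" for f :: "'a \<times> 'b \<Rightarrow>\<^sub>0 int"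
    proof -
      have add: "additive (abs_tensor :: ('a \<times> 'b \<Rightarrow>\<^sub>0 int) \<Rightarrow> _)"
        by standard (simp add: plus_tensor.abs_eq)
      have "additive (\<lambda>m. free_scale m f)"
        by standard (simp add: free.scale_left_distrib)
      from additive_zscale[OF this, of n 1] have "free_scale n f = zscale n f"
        by (simp add: zscale_def split: if_splits)
      then show ?thesis by (simp add: additive_zscale[OF add])
    qed
    ultimately have "abs_tensor (Poly_Mapping.single k n) = zscale n a \<otimes>\<^sub>\<int> b"
      by (simp add: k tens.abs_eq[symmetric] zs)
    then show ?case by (simp add: assms)
  next
    case (sum f g)
    then show ?case using assms(2) by (simp add: plus_tensor.abs_eq[symmetric])
  qed
  show ?thesis by (rule tensor.abs_induct) (rule main)
qed

context module
begin

lemma biadditive_act_inner: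
  "biadditive (\<lambda>m q. scale r m \<otimes>\<^sub>\<int> ((p::'z::comm_ring_1) * q))"
  by unfold_locales (simp_all add: scale_right_distrib distrib_left tens_add_left tens_add_right)

lemma biadditive_act_outer:
  "biadditive (\<lambda>r (p::'z::comm_ring_1). tensor_lift (\<lambda>m q. scale r m \<otimes>\<^sub>\<int> (p * q)) u)"
proof (unfold_locales)
  note lift = biadditive.tensor_lift_tens[OF biadditive_act_inner]
  note liftadd = biadditive.tensor_lift_add[OF biadditive_act_inner]
  fix r r' :: 'a and p p' :: 'z
  show "tensor_lift (\<lambda>m q. scale (r + r') m \<otimes>\<^sub>\<int> (p * q)) u =
      tensor_lift (\<lambda>m q. scale r m \<otimes>\<^sub>\<int> (p * q)) u + tensor_lift (\<lambda>m q. scale r' m \<otimes>\<^sub>\<int> (p * q)) u"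
  proof (induction u rule: tensor_induct)
    case (tens m q)
    show ?case unfolding lift by (simp only: scale_left_distrib tens_add_left)
  next
    case (add t u)
    show ?case by (simp only: liftadd add) (simp only: ac_simps)
  qed
  show "tensor_lift (\<lambda>m q. scale r m \<otimes>\<^sub>\<int> ((p + p') * q)) u =
      tensor_lift (\<lambda>m q. scale r m \<otimes>\<^sub>\<int> (p * q)) u + tensor_lift (\<lambda>m q. scale r m \<otimes>\<^sub>\<int> (p' * q)) u"
  proof (induction u rule: tensor_induct)
    case (tens m q)
    show ?case unfolding lift by (simp only: distrib_right tens_add_right)
  next
    case (add t u)
    show ?case by (simp only: liftadd add) (simp only: ac_simps)
  qed
qed

lemma tensor_act_tens:
  "tensor_act scale (r \<otimes>\<^sub>\<int> p) (m \<otimes>\<^sub>\<int> q) = scale r m \<otimes>\<^sub>\<int> (p * q)"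
  unfolding tensor_act_def biadditive.tensor_lift_tens[OF biadditive_act_outer]
  by (rule biadditive.tensor_lift_tens[OF biadditive_act_inner])

lemma tensor_act_add_left:
  "tensor_act scale (t + t') u = tensor_act scale t u + tensor_act scale t' u"
  unfolding tensor_act_def by (rule biadditive.tensor_lift_add[OF biadditive_act_outer])

lemma tensor_act_add_right:
  "tensor_act scale t (u + u') = tensor_act scale t u + tensor_act scale t u'"
proof (induction t rule: tensor_induct)
  case (tens a b)
  show ?case
    unfolding tensor_act_def biadditive.tensor_lift_tens[OF biadditive_act_outer]
    by (rule biadditive.tensor_lift_add[OF biadditive_act_inner])
next
  case (add t t')
  then show ?case by (simp only: tensor_act_add_left ac_simps)
qed

end


section \<open>Inverting 2\<close>

typedef zhalf = "{q :: rat. \<exists>a k. q = of_int a / 2 ^ k}"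
  morphisms rat_of_zhalf Abs_zhalf
  by (rule exI[of _ 0]) (auto intro: exI[of _ 0])

setup_lifting type_definition_zhalf

instantiation zhalf :: comm_ring_1
begin
lift_definition zero_zhalf :: zhalf is 0 by (auto intro: exI[of _ 0])
lift_definition one_zhalf :: zhalf is 1 by (rule exI[of _ 1], rule exI[of _ 0]) simp
lift_definition plus_zhalf :: "zhalf \<Rightarrow> zhalf \<Rightarrow> zhalf" is "(+)"
proof clarify
  fix a b :: int and k l
  show "\<exists>c n. rat_of_int a / 2 ^ k + rat_of_int b / 2 ^ l = rat_of_int c / 2 ^ n"
    by (rule exI[of _ "a * 2 ^ l + b * 2 ^ k"], rule exI[of _ "k + l"])
      (simp add: field_simps power_add)
qed
lift_definition minus_zhalf :: "zhalf \<Rightarrow> zhalf \<Rightarrow> zhalf" is "(-)"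
proof clarify
  fix a b :: int and k l
  show "\<exists>c n. rat_of_int a / 2 ^ k - rat_of_int b / 2 ^ l = rat_of_int c / 2 ^ n"
    by (rule exI[of _ "a * 2 ^ l - b * 2 ^ k"], rule exI[of _ "k + l"])
      (simp add: field_simps power_add)
qed
lift_definition uminus_zhalf :: "zhalf \<Rightarrow> zhalf" is uminus
  by (metis minus_divide_left of_int_minus)
lift_definition times_zhalf :: "zhalf \<Rightarrow> zhalf \<Rightarrow> zhalf" is "(*)"
proof clarify
  fix a b :: int and k l
  show "\<exists>c n. rat_of_int a / 2 ^ k * (rat_of_int b / 2 ^ l) = rat_of_int c / 2 ^ n"
    by (rule exI[of _ "a * b"], rule exI[of _ "k + l"]) (simp add: power_add)
qed
instance by standard (transfer; simp add: algebra_simps)+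
end

lift_definition half :: zhalf is "1 / 2"
  by (rule exI[of _ 1], rule exI[of _ 1]) simp

lemma half_add_half: "half + half = 1"
  by transfer simp

lemma tens_zscale_left: "zscale n a \<otimes>\<^sub>\<int> b = zscale n (a \<otimes>\<^sub>\<int> b)"
  by (rule additive_zscale) (standard, rule tens_add_left)

lemma tens_zscale_right: "a \<otimes>\<^sub>\<int> zscale n b = zscale n (a \<otimes>\<^sub>\<int> b)"
  by (rule additive_zscale) (standard, rule tens_add_right)

lemma zscale_ring: "zscale n (x :: 'r::comm_ring_1) = of_int n * x"
proof -
  have "n = int (nat n) - int (nat (- n))" by simp
  then have "(of_int n :: 'r) = of_nat (nat n) - of_nat (nat (- n))"
    by (metis of_int_diff of_int_of_nat_eq)
  then show ?thesis by (simp add: zscale_def left_diff_distrib)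
qed

lemma two_half: "2 * half = 1"
  using half_add_half by (metis mult_2)

lemma two_power_half_power: "2 ^ m * half ^ (n + m) = half ^ n"
  by (induction m) (simp_all add: two_half, metis (no_types, lifting) two_half mult.assoc mult.left_commute mult_1)

lemma tens_half_power: "a \<otimes>\<^sub>\<int> half ^ n = zscale (2 ^ m) a \<otimes>\<^sub>\<int> half ^ (n + m)"
  unfolding tens_zscale_left tens_zscale_right[symmetric] by (simp add: zscale_ring two_power_half_power)

lemma rat_of_zhalf_half_power: "rat_of_zhalf (half ^ n) = 1 / 2 ^ n"
  by (induction n) (simp_all add: one_zhalf.rep_eq times_zhalf.rep_eq half.rep_eq)

lemma rat_of_zhalf_of_int: "rat_of_zhalf (of_int n) = of_int n"
  by (induction n rule: int_induct[where k = 0])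
    (simp_all add: zero_zhalf.rep_eq one_zhalf.rep_eq plus_zhalf.rep_eq minus_zhalf.rep_eq)

lemma zhalf_cases: obtains n k where "b = of_int n * half ^ k"
proof -
  obtain n k where "rat_of_zhalf b = of_int n / 2 ^ k" using rat_of_zhalf[of b] by auto
  then have "b = of_int n * half ^ k"
    by (simp add: rat_of_zhalf_inject[symmetric] times_zhalf.rep_eq rat_of_zhalf_of_int
        rat_of_zhalf_half_power)
  then show ?thesis by (rule that)
qed

text \<open>\<open>A[1/2]\<close> is \<open>'a loc2\<close>.\<close>

type_synonym 'a loc2 = "('a, zhalf) tensor"


lemma loc2_cases:
  obtains a k where "(t :: 'a::ab_group_add loc2) = a \<otimes>\<^sub>\<int> half ^ k"
proof -
  have "\<exists>a k. t = a \<otimes>\<^sub>\<int> half ^ k"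
  proof (induction t rule: tensor_induct)
    case (tens a b)
    obtain n k where "b = of_int n * half ^ k" by (rule zhalf_cases)
    then have "a \<otimes>\<^sub>\<int> b = zscale n a \<otimes>\<^sub>\<int> half ^ k"
      by (simp add: tens_zscale_left tens_zscale_right[symmetric] zscale_ring)
    then show ?case by blast
  next
    case (add t u)
    then obtain a k b l where t: "t = a \<otimes>\<^sub>\<int> half ^ k" and u: "u = b \<otimes>\<^sub>\<int> half ^ l" by blast
    have "t + u = (zscale (2 ^ l) a + zscale (2 ^ k) b) \<otimes>\<^sub>\<int> half ^ (k + l)"
      unfolding tens_add_left t u
      using tens_half_power[of a k l] tens_half_power[of b l k] by (simp add: add.commute)
    then show ?case by blast
  qed
  then show ?thesis using that by blast
qed

lemma loc2_eq_0:
  assumes "a \<otimes>\<^sub>\<int> half ^ n = (0 :: 'a::ab_group_add loc2)"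
  shows "\<exists>m. zscale (2 ^ m) a = 0"
proof -
  define fl where "fl k b = \<lfloor>2 ^ k * rat_of_zhalf b\<rfloor>" for k b
  have fl_exact: "\<exists>K. \<forall>k\<ge>K. of_int (fl k b) = 2 ^ k * rat_of_zhalf b" for b
  proof -
    obtain c j where c: "rat_of_zhalf b = of_int c / 2 ^ j" using rat_of_zhalf[of b] by auto
    have "of_int (fl k b) = 2 ^ k * rat_of_zhalf b" if "k \<ge> j" for k
    proof -
      have "2 ^ k * rat_of_zhalf b = of_int (2 ^ (k - j) * c)"
        using that by (simp add: c field_simps power_add[symmetric])
      then show ?thesis unfolding fl_def by (simp only: floor_of_int)
    qed
    then show ?thesis by blast
  qed
  have fl_add: "\<exists>K. \<forall>k\<ge>K. fl k (b + b') = fl k b + fl k b'" for b b'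
  proof -
    obtain K where K: "\<forall>k\<ge>K. of_int (fl k b) = 2 ^ k * rat_of_zhalf b" using fl_exact by blast
    have "fl k (b + b') = fl k b + fl k b'" if "k \<ge> K" for k
    proof -
      have "2 ^ k * rat_of_zhalf (b + b') = of_int (fl k b) + 2 ^ k * rat_of_zhalf b'"
        using K that by (simp add: plus_zhalf.rep_eq distrib_left)
      then show ?thesis unfolding fl_def[of _ "b + b'"] fl_def[of _ b'] by (simp only: int_add_floor)
    qed
    then show ?thesis by blast
  qed
  define phi where "phi k = free_lift zscale (\<lambda>(a :: 'a, b). zscale (fl k b) a)" for k
  define S where "S = {f. \<exists>K. \<forall>k\<ge>K. phi k f = 0}"
  have "free.subspace S"
    unfolding free.subspace_def
  proof (intro conjI ballI allI)
    show "0 \<in> S" by (simp add: S_def phi_def free_lift_def)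
    fix f g assume "f \<in> S" "g \<in> S"
    then obtain K L where "\<forall>k\<ge>K. phi k f = 0" "\<forall>k\<ge>L. phi k g = 0" by (auto simp: S_def)
    then have "\<forall>k\<ge>max K L. phi k (f + g) = 0" by (simp add: phi_def zmod.free_lift_add)
    then show "f + g \<in> S" unfolding S_def by blast
  next
    fix c f assume "f \<in> S"
    then obtain K where "\<forall>k\<ge>K. phi k f = 0" by (auto simp: S_def)
    then have "\<forall>k\<ge>K. phi k (free_scale c f) = 0" by (simp add: phi_def zmod.free_lift_scale)
    then show "free_scale c f \<in> S" unfolding S_def by blast
  qed
  moreover have "bilinear_rels \<subseteq> S"
  proof
    fix f :: "'a \<times> zhalf \<Rightarrow>\<^sub>0 int" assume "f \<in> bilinear_rels"
    then consider a a' b where "f = Poly_Mapping.single (a + a', b) 1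
        - Poly_Mapping.single (a, b) 1 - Poly_Mapping.single (a', b) 1"
      | a b b' where "f = Poly_Mapping.single (a, b + b') 1
        - Poly_Mapping.single (a, b) 1 - Poly_Mapping.single (a, b') 1"
      by (auto simp: bilinear_rels_def)
    then show "f \<in> S"
    proof cases
      case 1
      then show ?thesis
        by (simp add: S_def phi_def zmod.free_lift_diff zmod.free_lift_single zmod.scale_right_distrib)
    next
      case (2 a b b')
      obtain K where "\<forall>k\<ge>K. fl k (b + b') = fl k b + fl k b'" using fl_add by blast
      then have "\<forall>k\<ge>K. phi k f = 0"
        by (simp add: 2 phi_def zmod.free_lift_diff zmod.free_lift_single zmod.scale_left_distrib)
      then show ?thesis unfolding S_def by blast
    qed
  qed
  ultimately have "free.span bilinear_rels \<subseteq> S" by (intro free.span_minimal)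
  moreover have "Poly_Mapping.single (a, half ^ n) 1 \<in> free.span bilinear_rels"
    using assms unfolding tens.abs_eq zero_tensor.abs_eq tensor.abs_eq_iff
    by (simp add: tensor_rel_def)
  ultimately obtain K where K: "\<forall>k\<ge>K. phi k (Poly_Mapping.single (a, half ^ n) 1) = 0"
    unfolding S_def by blast
  have "2 ^ (n + K) * rat_of_zhalf (half ^ n) = of_int (2 ^ K)"
    by (simp add: rat_of_zhalf_half_power power_add)
  then have "fl (n + K) (half ^ n) = 2 ^ K" unfolding fl_def by (simp only: floor_of_int)
  with K[rule_format, of "n + K"] have "zscale (2 ^ K) a = 0"
    by (simp add: phi_def zmod.free_lift_single)
  then show ?thesis ..
qed

text \<open>\<open>\<int>[1/2]\<close> is flat, so \<open>B[1/2]\<close> is a subgroup of \<open>A[1/2]\<close> for a subgroup \<open>B\<close> of \<open>A\<close>.\<close>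

lemma inj_tensor_map_loc2:
  assumes f: "additive f" and "inj f"
  shows "inj (tensor_map f (\<lambda>q. q) :: 'a::ab_group_add loc2 \<Rightarrow> 'b::ab_group_add loc2)"
proof (rule injI)
  have id: "additive (\<lambda>q :: zhalf. q)" by standard simp
  interpret T: additive "tensor_map f (\<lambda>q. q) :: 'a loc2 \<Rightarrow> 'b loc2"
    by (rule additive_tensor_map[OF f id])
  have ker: "t = 0" if "tensor_map f (\<lambda>q. q) t = 0" for t :: "'a loc2"
  proof -
    obtain a n where t: "t = a \<otimes>\<^sub>\<int> half ^ n" by (rule loc2_cases)
    with that have "f a \<otimes>\<^sub>\<int> half ^ n = 0" by (simp add: tensor_map_tens[OF f id])
    then obtain m where "zscale (2 ^ m) (f a) = 0" using loc2_eq_0 by blast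
    then have "f (zscale (2 ^ m) a) = f 0" by (simp add: additive_zscale[OF f] additive.zero[OF f])
    then have "zscale (2 ^ m) a = 0" using \<open>inj f\<close> by (rule injD[rotated])
    then show ?thesis
      unfolding t tens_half_power[of a n m] using tens_add_left[of 0 0 "half ^ (n + m)"] by simp
  qed
  fix t u :: "'a loc2"
  assume "tensor_map f (\<lambda>q. q) t = tensor_map f (\<lambda>q. q) u"
  then have "tensor_map f (\<lambda>q. q) (t - u) = 0" by (simp add: T.diff)
  then show "t = u" using ker by fastforce
qed


section \<open>Square classes and their integral group ring\<close>

definition sqclass_rel :: "'a::field \<Rightarrow> 'a \<Rightarrow> bool"
  where "sqclass_rel x y \<longleftrightarrow> x \<noteq> 0 \<and> y \<noteq> 0 \<and> (\<exists>z. z \<noteq> 0 \<and> x = y * z\<^sup>2)"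

lemma part_equivp_sqclass_rel: "part_equivp (sqclass_rel :: 'a::field \<Rightarrow> _)"
proof (rule part_equivpI)
  show "\<exists>x::'a. sqclass_rel x x"
    by (rule exI[of _ 1]) (auto simp: sqclass_rel_def intro: exI[of _ 1])
  show "symp (sqclass_rel :: 'a \<Rightarrow> _)"
  proof (rule sympI)
    fix x y :: 'a assume "sqclass_rel x y"
    then obtain z where "x \<noteq> 0" "y \<noteq> 0" "z \<noteq> 0" "x = y * z\<^sup>2" by (auto simp: sqclass_rel_def)
    then show "sqclass_rel y x"
      by (auto simp: sqclass_rel_def field_simps intro!: exI[of _ "inverse z"])
  qed
  show "transp (sqclass_rel :: 'a \<Rightarrow> _)"
  proof (rule transpI)
    fix x y w :: 'a assume "sqclass_rel x y" "sqclass_rel y w"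
    then obtain z z' where "w \<noteq> 0" "z \<noteq> 0" "z' \<noteq> 0" "x = y * z\<^sup>2" "y = w * z'\<^sup>2"
      by (auto simp: sqclass_rel_def)
    then show "sqclass_rel x w"
      by (auto simp: sqclass_rel_def power_mult_distrib intro!: exI[of _ "z' * z"])
  qed
qed

text \<open>The group \<open>F\<^sup>\<times>/(F\<^sup>\<times>)\<^sup>2\<close>, written additively because the multiplication of
  \<open>'b \<Rightarrow>\<^sub>0 int\<close> is the convolution product over an additive monoid \<open>'b\<close>.\<close>

quotient_type (overloaded) 'a sqclass = "'a::field" / partial: sqclass_rel
  by (rule part_equivp_sqclass_rel)

instantiation sqclass :: (field) ab_group_add
begin
lift_definition zero_sqclass :: "'a sqclass" is 1
  by (auto simp: sqclass_rel_def intro: exI[of _ 1])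
lift_definition plus_sqclass :: "'a sqclass \<Rightarrow> 'a sqclass \<Rightarrow> 'a sqclass" is "(*)"
proof -
  fix x x' y y' :: 'a assume "sqclass_rel x x'" "sqclass_rel y y'"
  then obtain z w where "x' \<noteq> 0" "y' \<noteq> 0" "z \<noteq> 0" "w \<noteq> 0" "x = x' * z\<^sup>2" "y = y' * w\<^sup>2"
    by (auto simp: sqclass_rel_def)
  then show "sqclass_rel (x * y) (x' * y')"
    by (auto simp: sqclass_rel_def power_mult_distrib intro!: exI[of _ "z * w"])
qed
lift_definition uminus_sqclass :: "'a sqclass \<Rightarrow> 'a sqclass" is inverse
proof -
  fix x x' :: 'a assume "sqclass_rel x x'"
  then obtain z where "x' \<noteq> 0" "z \<noteq> 0" "x = x' * z\<^sup>2" by (auto simp: sqclass_rel_def)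
  then show "sqclass_rel (inverse x) (inverse x')"
    by (auto simp: sqclass_rel_def power_inverse intro!: exI[of _ "inverse z"])
qed
definition minus_sqclass :: "'a sqclass \<Rightarrow> 'a sqclass \<Rightarrow> 'a sqclass"
  where "minus_sqclass a b = a + - b"
instance
proof
  fix a b c :: "'a sqclass"
  have refl: "sqclass_rel x x" if "x \<noteq> 0" for x :: 'a
    using that by (auto simp: sqclass_rel_def intro: exI[of _ 1])
  show "a + b + c = a + (b + c)"
    by transfer (simp add: mult.assoc, auto intro!: refl simp: sqclass_rel_def)
  show "a + b = b + a"
    by transfer (auto simp: mult.commute sqclass_rel_def intro!: exI[of _ 1])
  show "0 + a = a"
    by transfer simp
  show "- a + a = 0"
    by transfer (auto simp: sqclass_rel_def intro!: exI[of _ 1])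
  show "a - b = a + - b"
    by (rule minus_sqclass_def)
qed
end

text \<open>The ring \<open>R\<^sub>F\<close>.\<close>

type_synonym 'a sqring = "'a sqclass \<Rightarrow>\<^sub>0 int"

text \<open>The value at 0 is junk (the class of 1).\<close>

lift_definition sqclass_of :: "'a::field \<Rightarrow> 'a sqclass" is "\<lambda>x. if x = 0 then 1 else x"
  by (auto simp: sqclass_rel_def intro: exI[of _ 1])

definition sq :: "'a::field \<Rightarrow> 'a sqring"  (\<open>\<langle>_\<rangle>\<close>)
  where "\<langle>x\<rangle> = Poly_Mapping.single (sqclass_of x) 1"

definition pfister :: "'a::field \<Rightarrow> 'a sqring"  (\<open>\<langle>\<langle>_\<rangle>\<rangle>\<close>)
  where "\<langle>\<langle>x\<rangle>\<rangle> = \<langle>x\<rangle> - 1"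

definition augmentation :: "'a::field sqring \<Rightarrow> int"
  where "augmentation a = (\<Sum>g\<in>Poly_Mapping.keys a. Poly_Mapping.lookup a g)"

definition aug_ideal :: "'a::field sqring set"
  where "aug_ideal = {a. augmentation a = 0}"

lemma ring_self: "module ((*) :: 'r::comm_ring_1 \<Rightarrow> 'r \<Rightarrow> 'r)"
  by standard (simp_all add: algebra_simps)

definition aug_ideal_sq :: "'a::field sqring set"
  where "aug_ideal_sq = module.span (*) (\<Union>a\<in>aug_ideal. \<Union>b\<in>aug_ideal. {a * b})"

lemma sq_mult: "x \<noteq> 0 \<Longrightarrow> y \<noteq> 0 \<Longrightarrow> \<langle>x * y\<rangle> = \<langle>x\<rangle> * \<langle>y :: 'a::field\<rangle>"
proof -
  assume "x \<noteq> 0" "y \<noteq> 0"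
  then have "sqclass_of (x * y) = sqclass_of x + sqclass_of y"
    by transfer (auto simp: sqclass_rel_def intro: exI[of _ 1])
  then show ?thesis by (simp add: sq_def mult_single)
qed

lemma sq_one [simp]: "\<langle>1 :: 'a::field\<rangle> = 1"
proof -
  have "sqclass_of (1 :: 'a) = 0"
    by transfer (auto simp: sqclass_rel_def intro: exI[of _ 1])
  then show ?thesis by (simp add: sq_def)
qed

lemma sq_self [simp]: "\<langle>x\<rangle> * \<langle>x :: 'a::field\<rangle> = 1"
proof -
  have "sqclass_of x + sqclass_of x = 0"
    by transfer (auto simp: sqclass_rel_def power2_eq_square intro: exI[of _ 1])
  then show ?thesis by (simp add: sq_def mult_single)
qed

lemma sq_inverse: "x \<noteq> 0 \<Longrightarrow> \<langle>inverse x\<rangle> = \<langle>x :: 'a::field\<rangle>"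
proof -
  assume "x \<noteq> 0"
  then have "\<langle>inverse x\<rangle> * \<langle>x\<rangle> = 1" by (simp add: sq_mult[symmetric])
  then have "\<langle>inverse x\<rangle> * \<langle>x\<rangle> * \<langle>x\<rangle> = \<langle>x\<rangle>" by simp
  then show ?thesis by (simp add: mult.assoc)
qed

lemma sq_divide: "x \<noteq> 0 \<Longrightarrow> y \<noteq> 0 \<Longrightarrow> \<langle>x / y\<rangle> = \<langle>x\<rangle> * \<langle>y :: 'a::field\<rangle>"
  by (simp add: divide_inverse sq_mult sq_inverse)

lemma pfister_in_aug_ideal: "\<langle>\<langle>x\<rangle>\<rangle> \<in> aug_ideal"
proof -
  have "augmentation a = free_lift (*) (\<lambda>_. 1) a" for a :: "'a sqring"
    by (simp add: augmentation_def free_lift_def)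
  moreover have "free_lift (*) (\<lambda>_. 1) (1 :: 'a sqring) = (1 :: int)"
    using module.free_lift_single[OF ring_self, of "\<lambda>_. 1 :: int" "0 :: 'a sqclass" 1] by simp
  ultimately show ?thesis
    by (simp add: aug_ideal_def pfister_def sq_def module.free_lift_diff[OF ring_self]
        module.free_lift_single[OF ring_self])
qed

lemma subspace_aug_ideal: "module.subspace (*) (aug_ideal :: 'a::field sqring set)"
proof -
  have aug: "augmentation a = free_lift (*) (\<lambda>_. 1) a" for a :: "'a sqring"
    by (simp add: augmentation_def free_lift_def)
  have mult: "augmentation (a * b) = augmentation a * augmentation b" for a b :: "'a sqring"
  proof (induction a rule: poly_mapping_add_induct)
    case (single k n)
    show ?case
    proof (induction b rule: poly_mapping_add_induct)
      case (single l m)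
      show ?case by (simp add: mult_single aug module.free_lift_single[OF ring_self])
    qed (simp add: distrib_left aug module.free_lift_add[OF ring_self])
  qed (simp add: distrib_right aug module.free_lift_add[OF ring_self])
  have "augmentation (a + b) = augmentation a + augmentation b" for a b :: "'a sqring"
    by (simp add: aug module.free_lift_add[OF ring_self])
  with mult show ?thesis
    by (auto simp: module.subspace_def[OF ring_self] aug_ideal_def) (simp add: augmentation_def)
qed

text \<open>\<open>(1 + \<langle>-1\<rangle>) I\<^sub>F\<close>.\<close>

definition aug_ideal_plus :: "'a::field sqring set"
  where "aug_ideal_plus = (\<lambda>a. (1 + \<langle>-1\<rangle>) * a) ` aug_ideal"

lemma subspace_aug_ideal_plus: "module.subspace (*) (aug_ideal_plus :: 'a::field sqring set)"
proof -
  have "module_hom (*) (*) (\<lambda>a :: 'a sqring. (1 + \<langle>-1\<rangle>) * a)"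
    by unfold_locales (simp_all add: algebra_simps)
  from module_hom.subspace_image[OF this subspace_aug_ideal] show ?thesis
    by (simp add: aug_ideal_plus_def)
qed


section \<open>The refined scissors congruence group\<close>

lifting_forget sqclass.lifting

abbreviation free_bracket :: "'a::field \<Rightarrow> ('a \<Rightarrow>\<^sub>0 'a sqring)"
  where "free_bracket x \<equiv> Poly_Mapping.single x 1"

definition five_term :: "'a::field \<Rightarrow> 'a \<Rightarrow> ('a \<Rightarrow>\<^sub>0 'a sqring)"
  where "five_term x y =
    free_bracket x - free_bracket y + free_scale \<langle>x\<rangle> (free_bracket (y / x))
    - free_scale \<langle>inverse x - 1\<rangle> (free_bracket ((1 - inverse x) / (1 - inverse y)))
    + free_scale \<langle>1 - x\<rangle> (free_bracket ((1 - x) / (1 - y)))"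

text \<open>Generators are indexed by all of \<open>F\<close> rather than \<open>F\<^sup>\<times>\<close>. The extra generator at
  0 is killed, except for the field with two elements, where it is the distinguished
  generator of the group of order 3 (and \<open>R\<^sub>F\<close> is \<open>\<int>\<close>). \<open>CARD('a)\<close> is 0 for infinite fields.\<close>

definition rp_rels :: "('a::field \<Rightarrow>\<^sub>0 'a sqring) set"
  where "rp_rels =
    (if CARD('a) = 2 then {free_bracket 1, free_scale 3 (free_bracket 0)}
     else if CARD('a) = 3 then {free_bracket 0, free_bracket 1,
       free_scale 2 (free_bracket (-1) + free_scale \<langle>-1\<rangle> (free_bracket (-1)))}
     else {free_bracket 0, free_bracket 1} \<union> (\<Union>x\<in>- {0, 1}. \<Union>y\<in>- {0, 1}. {five_term x y}))"

definition rp_rel :: "('a::field \<Rightarrow>\<^sub>0 'a sqring) \<Rightarrow> ('a \<Rightarrow>\<^sub>0 'a sqring) \<Rightarrow> bool"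
  where "rp_rel f g \<longleftrightarrow> f - g \<in> free.span rp_rels"

quotient_type (overloaded) 'a rp = "'a::field \<Rightarrow>\<^sub>0 'a sqring" / rp_rel
  unfolding rp_rel_def by (rule free.equivp_subspace) simp

instantiation rp :: (field) ab_group_add
begin
lift_definition zero_rp :: "'a rp" is 0 .
lift_definition plus_rp :: "'a rp \<Rightarrow> 'a rp \<Rightarrow> 'a rp"
  is "(+)" unfolding rp_rel_def by (rule free.subspace_add_cong) auto
lift_definition minus_rp :: "'a rp \<Rightarrow> 'a rp \<Rightarrow> 'a rp"
  is "(-)" unfolding rp_rel_def by (rule free.subspace_diff_cong) auto
lift_definition uminus_rp :: "'a rp \<Rightarrow> 'a rp"
  is uminus unfolding rp_rel_def by (rule free.subspace_uminus_cong) auto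
instance
  by standard (transfer; simp add: rp_rel_def free.span_zero algebra_simps)+
end

lift_definition rp_scale :: "'a::field sqring \<Rightarrow> 'a rp \<Rightarrow> 'a rp"  (infixr \<open>*\<^sub>R\<^sub>P\<close> 75)
  is free_scale unfolding rp_rel_def by (rule free.subspace_scale_cong) auto

interpretation rp: module rp_scale
  by standard (transfer; simp add: rp_rel_def free.span_zero algebra_simps)+

lift_definition bracket :: "'a::field \<Rightarrow> 'a rp" is free_bracket .

definition lambda1_gen :: "'a::field \<Rightarrow> 'a sqring"
  where "lambda1_gen x = (if x = 0 \<or> x = 1 then 0 else \<langle>\<langle>1 - x\<rangle>\<rangle> * \<langle>\<langle>x\<rangle>\<rangle>)"

lemma five_term_identity:
  fixes X Y A B E :: "'r::comm_ring_1"
  assumes "X * X = 1" "A * A = 1" "B * B = 1" "E * E = 1"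
  shows "(A - 1) * (X - 1) - (B - 1) * (Y - 1) + X * ((E * X - 1) * (Y * X - 1))
      - A * X * ((E * (B * X) - 1) * (A * Y * (B * X) - 1)) + A * ((E * B - 1) * (A * B - 1)) = 0"
proof -
  have 1: "X * ((E * X - 1) * (Y * X - 1)) = E * Y * X * (X * X) - E * (X * X) - Y * (X * X) + X"
    by (simp only: algebra_simps mult_1_left mult_1_right)
  have 2: "A * X * ((E * (B * X) - 1) * (A * Y * (B * X) - 1))
      = E * Y * X * (A * A) * (B * B) * (X * X) - A * B * E * (X * X) - B * Y * (A * A) * (X * X) + A * X"
    by (simp only: algebra_simps mult_1_left mult_1_right)
  have 3: "A * ((E * B - 1) * (A * B - 1)) = E * (A * A) * (B * B) - A * B * E - B * (A * A) + A"
    by (simp only: algebra_simps mult_1_left mult_1_right)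
  show ?thesis unfolding 1 2 3 assms by (simp add: algebra_simps)
qed
lemma psi_identity:
  fixes N U X :: "'r::comm_ring_1"
  assumes "N * N = 1" "X * X = 1"
  shows "(U - 1) * (X - 1) + N * ((N * (U * X) - 1) * (X - 1)) = (1 + N) * (1 - X)"
proof -
  have "N * ((N * (U * X) - 1) * (X - 1)) = U * (N * N) * (X * X) - U * X * (N * N) - N * X + N"
    by (simp only: algebra_simps mult_1_left mult_1_right)
  then show ?thesis unfolding assms by (simp add: algebra_simps)
qed

lemma lambda1_five_term:
  fixes x y :: "'a::field"
  assumes "x \<noteq> 0" "x \<noteq> 1" "y \<noteq> 0" "y \<noteq> 1"
  shows "free_lift (*) lambda1_gen (five_term x y) = 0"
proof -
  have *: "free_lift (*) lambda1_gen (five_term x y) =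
    lambda1_gen x - lambda1_gen y + \<langle>x\<rangle> * lambda1_gen (y / x)
    - \<langle>inverse x - 1\<rangle> * lambda1_gen ((1 - inverse x) / (1 - inverse y))
    + \<langle>1 - x\<rangle> * lambda1_gen ((1 - x) / (1 - y))"
    by (simp add: five_term_def module.free_lift_diff[OF ring_self] module.free_lift_add[OF ring_self]
        module.free_lift_scale[OF ring_self] module.free_lift_single[OF ring_self])
  have nz: "1 - x \<noteq> 0" "1 - y \<noteq> 0" "1 - inverse y \<noteq> 0" "1 - inverse x \<noteq> 0"
    using assms by (auto simp: field_simps)
  show ?thesis
  proof (cases "x = y")
    case True
    moreover have "lambda1_gen (1 :: 'a) = 0" by (simp add: lambda1_gen_def)
    ultimately show ?thesis unfolding * using assms nz by simp
  next
    case False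
    define X Y A B E where "X = \<langle>x\<rangle>" "Y = \<langle>y\<rangle>" "A = \<langle>1 - x\<rangle>" "B = \<langle>1 - y\<rangle>" "E = \<langle>x - y\<rangle>"
    note defs = this
    have sqs: "X * X = 1" "A * A = 1" "B * B = 1" "E * E = 1"
      by (simp_all add: defs)
    have xy: "x - y \<noteq> 0" using False by simp
    have "1 - y / x = (x - y) / x" using assms by (simp add: field_simps)
    then have t3: "lambda1_gen (y / x) = (E * X - 1) * (Y * X - 1)"
      using assms False xy by (simp add: lambda1_gen_def pfister_def sq_divide defs)
    have "inverse x - 1 = (1 - x) / x" using assms by (simp add: field_simps)
    then have c4: "\<langle>inverse x - 1\<rangle> = A * X"
      using assms nz by (simp add: sq_divide defs)
    have u: "(1 - inverse x) / (1 - inverse y) = ((1 - x) * y) / ((1 - y) * x)"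
    proof -
      have "1 - inverse x = - ((1 - x) / x)" "1 - inverse y = - ((1 - y) / y)"
        using assms by (simp_all add: divide_inverse algebra_simps)
      then show ?thesis by simp
    qed
    have u': "1 - ((1 - x) * y) / ((1 - y) * x) = (x - y) / ((1 - y) * x)"
    proof -
      have "1 - p / q = (q - p) / q" if "q \<noteq> 0" for p q :: 'a
        using that by (simp add: diff_divide_distrib)
      moreover have "(1 - y) * x - (1 - x) * y = x - y" by (simp add: algebra_simps)
      ultimately show ?thesis using assms nz by simp
    qed
    then have u1: "((1 - x) * y) / ((1 - y) * x) \<noteq> 1" using xy assms nz by auto
    have t4: "lambda1_gen ((1 - inverse x) / (1 - inverse y))
        = (E * (B * X) - 1) * (A * Y * (B * X) - 1)"
      unfolding u using assms nz xy u' u1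
      by (simp add: lambda1_gen_def pfister_def sq_divide sq_mult defs)
    have v': "1 - (1 - x) / (1 - y) = (x - y) / (1 - y)"
      using nz by (simp add: field_simps)
    then have v1: "(1 - x) / (1 - y) \<noteq> 1" using xy nz by auto
    have t5: "lambda1_gen ((1 - x) / (1 - y)) = (E * B - 1) * (A * B - 1)"
      using nz xy v' v1 by (simp add: lambda1_gen_def pfister_def sq_divide defs)
    have t12: "lambda1_gen x = (A - 1) * (X - 1)" "lambda1_gen y = (B - 1) * (Y - 1)"
      using assms by (simp_all add: lambda1_gen_def pfister_def defs)
    have "(A - 1) * (X - 1) - (B - 1) * (Y - 1) + X * ((E * X - 1) * (Y * X - 1))
      - A * X * ((E * (B * X) - 1) * (A * Y * (B * X) - 1)) + A * ((E * B - 1) * (A * B - 1)) = 0"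
      by (rule five_term_identity) (rule sqs)+
    then show ?thesis
      unfolding * t3 t4 t5 c4 t12 by (simp add: defs)
  qed
qed

lemma lambda1_rels: "f \<in> rp_rels \<Longrightarrow> free_lift (*) lambda1_gen f = 0"
proof -
  assume f: "f \<in> rp_rels"
  have three: "free_lift (*) lambda1_gen
      (free_scale 2 (free_bracket (-1) + free_scale \<langle>-1 :: 'a\<rangle> (free_bracket (-1)))) = 0"
  proof -
    have "(1 + \<langle>-1 :: 'a\<rangle>) * lambda1_gen (-1) = 0"
    proof -
      have "(1 + N) * (M * (N - 1)) = 0" if "N * N = 1" for N M :: "'a sqring"
      proof -
        have "N * (N * Z) = Z" for Z by (simp add: mult.assoc[symmetric] that)
        then show ?thesis by (simp add: algebra_simps that)
      qed
      then show ?thesis by (auto simp: lambda1_gen_def pfister_def)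
    qed
    then show ?thesis
      by (simp add: module.free_lift_add[OF ring_self] module.free_lift_scale[OF ring_self]
          module.free_lift_single[OF ring_self] distrib_right)
  qed
  have *: "free_lift (*) lambda1_gen (free_bracket (0 :: 'a)) = 0"
    "free_lift (*) lambda1_gen (free_bracket (1 :: 'a)) = 0"
    by (simp_all add: module.free_lift_single[OF ring_self] lambda1_gen_def del: single_one)
  show ?thesis
  proof (cases "CARD('a) = 2 \<or> CARD('a) = 3")
    case True
    then have "f \<in> {free_bracket 1, free_scale 3 (free_bracket 0), free_bracket 0,
        free_scale 2 (free_bracket (-1) + free_scale \<langle>-1\<rangle> (free_bracket (-1)))}"
      using f by (simp only: rp_rels_def split: if_splits) blast+
    then show ?thesis
      using three * by (elim insertE emptyE) (simp_all only: module.free_lift_scale[OF ring_self] mult_zero_right)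
  next
    case False
    then consider "f = free_bracket 0" | "f = free_bracket 1"
      | x y where "x \<notin> {0, 1}" "y \<notin> {0, 1}" "f = five_term x y"
      using f by (simp only: rp_rels_def split: if_splits) blast+
    then show ?thesis
    proof cases
      case (3 x y)
      then show ?thesis by (simp add: lambda1_five_term)
    qed (simp_all only: *)
  qed
qed

lift_definition lambda1 :: "'a::field rp \<Rightarrow> 'a sqring" is "free_lift (*) lambda1_gen"
proof -
  fix f g :: "'a \<Rightarrow>\<^sub>0 'a sqring"
  assume "rp_rel f g"
  then have "free_lift (*) lambda1_gen (f - g) = 0"
    unfolding rp_rel_def by (rule module.free_lift_span_0[OF ring_self, rotated]) (rule lambda1_rels)
  then show "free_lift (*) lambda1_gen f = free_lift (*) lambda1_gen g"
    by (simp add: module.free_lift_diff[OF ring_self])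
qed

lemma lambda1_bracket: "lambda1 (bracket x) = lambda1_gen x"
  by transfer (simp add: module.free_lift_single[OF ring_self])

lemma module_hom_lambda1: "module_hom rp_scale (*) (lambda1 :: 'a::field rp \<Rightarrow> _)"
proof -
  have "lambda1 (a + b) = lambda1 a + lambda1 b" for a b :: "'a rp"
    by transfer (rule module.free_lift_add[OF ring_self])
  moreover have "lambda1 (r *\<^sub>R\<^sub>P a) = r * lambda1 a" for r and a :: "'a rp"
    by transfer (rule module.free_lift_scale[OF ring_self])
  ultimately show ?thesis
    unfolding module_hom_iff using rp.module_axioms ring_self by blast
qed

lemmas lambda1_add = module_hom.add[OF module_hom_lambda1]
  and lambda1_diff = module_hom.diff[OF module_hom_lambda1]
  and lambda1_scale = module_hom.scale[OF module_hom_lambda1]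

lemma lambda1_in_aug_ideal_sq: "lambda1 a \<in> aug_ideal_sq"
proof (transfer, unfold free_lift_def aug_ideal_sq_def, rule module.span_sum[OF ring_self], rule module.span_scale[OF ring_self])
  fix x :: 'a
  show "lambda1_gen x \<in> module.span (*) (\<Union>a\<in>aug_ideal. \<Union>b\<in>aug_ideal. {a * b})"
  proof (cases "x = 0 \<or> x = 1")
    case True
    then show ?thesis by (simp add: lambda1_gen_def module.span_zero[OF ring_self])
  next
    case False
    have "\<langle>\<langle>1 - x\<rangle>\<rangle> * \<langle>\<langle>x\<rangle>\<rangle> \<in> (\<Union>a\<in>aug_ideal. \<Union>b\<in>aug_ideal. {a * b})"
      by (rule UN_I[OF pfister_in_aug_ideal[of "1 - x"] UN_I[OF pfister_in_aug_ideal[of x] singletonI]])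
    with False show ?thesis
      by (simp only: lambda1_gen_def if_False module.span_base[OF ring_self])
  qed
qed


lifting_forget rp.lifting


section \<open>The quotient by \<open>K\<^sup>(\<^sup>1\<^sup>)\<close>\<close>

definition psi1 :: "'a::field \<Rightarrow> 'a rp"
  where "psi1 x = bracket x + \<langle>-1\<rangle> *\<^sub>R\<^sub>P bracket (inverse x)"

definition K1 :: "'a::field rp set"
  where "K1 = rp.span (psi1 ` (- {0}))"

definition rpt_rel :: "'a::field rp \<Rightarrow> 'a rp \<Rightarrow> bool"
  where "rpt_rel a b \<longleftrightarrow> a - b \<in> K1"

lemma subspace_K1: "rp.subspace K1"
  by (simp add: K1_def)

quotient_type (overloaded) 'a rpt = "'a::field rp" / rpt_rel
  unfolding rpt_rel_def by (rule rp.equivp_subspace) (rule subspace_K1)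

instantiation rpt :: (field) ab_group_add
begin
lift_definition zero_rpt :: "'a rpt" is 0 .
lift_definition plus_rpt :: "'a rpt \<Rightarrow> 'a rpt \<Rightarrow> 'a rpt"
  is "(+)" unfolding rpt_rel_def by (rule rp.subspace_add_cong[OF subspace_K1])
lift_definition minus_rpt :: "'a rpt \<Rightarrow> 'a rpt \<Rightarrow> 'a rpt"
  is "(-)" unfolding rpt_rel_def by (rule rp.subspace_diff_cong[OF subspace_K1])
lift_definition uminus_rpt :: "'a rpt \<Rightarrow> 'a rpt"
  is uminus unfolding rpt_rel_def by (rule rp.subspace_uminus_cong[OF subspace_K1])
instance
  by standard
    (transfer; simp add: rpt_rel_def rp.subspace_0[OF subspace_K1] algebra_simps)+
end

lift_definition rpt_scale :: "'a::field sqring \<Rightarrow> 'a rpt \<Rightarrow> 'a rpt"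
  is rp_scale unfolding rpt_rel_def by (rule rp.subspace_scale_cong[OF subspace_K1])

interpretation rpt: module rpt_scale
  by standard
    (transfer; simp add: rpt_rel_def rp.subspace_0[OF subspace_K1] algebra_simps)+

lift_definition rp_to_rpt :: "'a::field rp \<Rightarrow> 'a rpt" is "\<lambda>a. a" .

lemma module_hom_rp_to_rpt: "module_hom rp_scale rpt_scale (rp_to_rpt :: 'a::field rp \<Rightarrow> _)"
  by unfold_locales (transfer; simp add: rpt_rel_def rp.subspace_0[OF subspace_K1])+

lemma lambda1_psi1: "x \<noteq> 0 \<Longrightarrow> lambda1 (psi1 x) \<in> (aug_ideal_plus :: 'a::field sqring set)"
proof -
  assume x: "x \<noteq> 0"
  have eq: "lambda1 (psi1 x) = lambda1_gen x + \<langle>-1\<rangle> * lambda1_gen (inverse x)"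
    by (simp add: psi1_def lambda1_add lambda1_scale lambda1_bracket)
  show ?thesis
  proof (cases "x = 1")
    case True
    then show ?thesis
      unfolding eq by (simp add: lambda1_gen_def module.subspace_0[OF ring_self subspace_aug_ideal_plus])
  next
    case False
    have inv: "1 - inverse x = (-1) * ((1 - x) / x)"
      using x by (simp add: divide_inverse algebra_simps)
    have "\<langle>1 - inverse x\<rangle> = \<langle>-1\<rangle> * (\<langle>1 - x\<rangle> * \<langle>x\<rangle>)"
    proof -
      have "\<langle>1 - inverse x\<rangle> = \<langle>-1\<rangle> * \<langle>(1 - x) / x\<rangle>"
        unfolding inv using x False by (intro sq_mult) auto
      then show ?thesis using x False by (simp add: sq_divide)
    qed
    then have "lambda1 (psi1 x) = (\<langle>1 - x\<rangle> - 1) * (\<langle>x\<rangle> - 1)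
        + \<langle>-1\<rangle> * ((\<langle>-1\<rangle> * (\<langle>1 - x\<rangle> * \<langle>x\<rangle>) - 1) * (\<langle>x\<rangle> - 1))"
      using x False by (simp add: eq lambda1_gen_def pfister_def sq_inverse)
    also have "\<dots> = (1 + \<langle>-1\<rangle>) * (1 - \<langle>x\<rangle>)"
      by (rule psi_identity) simp_all
    finally have "lambda1 (psi1 x) = (1 + \<langle>-1\<rangle>) * (- \<langle>\<langle>x\<rangle>\<rangle>)"
      by (simp add: pfister_def)
    moreover have "(1 + \<langle>-1\<rangle>) * (- \<langle>\<langle>x\<rangle>\<rangle>) \<in> aug_ideal_plus"
      unfolding aug_ideal_plus_def
      by (rule imageI)
        (rule module.subspace_neg[OF ring_self subspace_aug_ideal pfister_in_aug_ideal])
    ultimately show ?thesis by (simp only:)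
  qed
qed

lemma lambda1_K1: "(a :: 'a::field rp) \<in> K1 \<Longrightarrow> lambda1 a \<in> aug_ideal_plus"
proof -
  have "(K1 :: 'a rp set) \<subseteq> lambda1 -` aug_ideal_plus"
    unfolding K1_def
  proof (rule rp.span_minimal)
    show "rp.subspace (lambda1 -` aug_ideal_plus :: 'a rp set)"
      by (rule module_hom.subspace_vimage[OF module_hom_lambda1 subspace_aug_ideal_plus])
  qed (use lambda1_psi1 in auto)
  then show "a \<in> K1 \<Longrightarrow> lambda1 a \<in> aug_ideal_plus" by auto
qed

text \<open>The map to \<open>I\<^sub>F\<^sup>2/(1 + \<langle>-1\<rangle>)I\<^sub>F\<close> induced by \<open>\<lambda>\<^sub>1\<close>; elements of the target are
  cosets of \<open>(1 + \<langle>-1\<rangle>)I\<^sub>F\<close>, the zero element being \<open>(1 + \<langle>-1\<rangle>)I\<^sub>F\<close> itself.\<close>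

definition aug_coset :: "'a::field sqring \<Rightarrow> 'a sqring set"
  where "aug_coset a = (\<lambda>j. a + j) ` aug_ideal_plus"

lift_definition lambda1_tilde :: "'a::field rpt \<Rightarrow> 'a sqring set" is "\<lambda>a. aug_coset (lambda1 a)"
proof -
  fix a b :: "'a rp"
  have sub: "aug_coset (lambda1 a) \<subseteq> aug_coset (lambda1 b)" if "a - b \<in> K1" for a b :: "'a rp"
  proof
    fix c assume "c \<in> aug_coset (lambda1 a)"
    then obtain j where j: "j \<in> aug_ideal_plus" "c = lambda1 a + j" by (auto simp: aug_coset_def)
    have "(lambda1 a - lambda1 b) + j \<in> aug_ideal_plus"
      using lambda1_K1[OF that] j
      by (intro module.subspace_add[OF ring_self subspace_aug_ideal_plus]) (simp_all add: lambda1_diff)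
    moreover have "c = lambda1 b + ((lambda1 a - lambda1 b) + j)" using j by simp
    ultimately show "c \<in> aug_coset (lambda1 b)" unfolding aug_coset_def by blast
  qed
  assume "rpt_rel a b"
  then have "a - b \<in> K1" by (simp add: rpt_rel_def)
  moreover from this have "b - a \<in> K1" using rp.subspace_neg[OF subspace_K1] by force
  ultimately show "aug_coset (lambda1 a) = aug_coset (lambda1 b)"
    by (intro subset_antisym sub)
qed

lemma lambda1_tilde_in: "lambda1_tilde t \<in> aug_coset ` aug_ideal_sq"
  by (induct t rule: rpt.abs_induct)
    (simp only: lambda1_tilde.abs_eq, rule imageI, rule lambda1_in_aug_ideal_sq)

definition rpt1 :: "'a::field rpt set"
  where "rpt1 = {t. lambda1_tilde t = aug_ideal_plus}"

lemma rp_to_rpt_in_rpt1_iff: "rp_to_rpt a \<in> rpt1 \<longleftrightarrow> lambda1 a \<in> aug_ideal_plus"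
proof
  assume "rp_to_rpt a \<in> rpt1"
  then have "aug_coset (lambda1 a) = aug_ideal_plus"
    unfolding rpt1_def by (auto simp: rp_to_rpt.abs_eq lambda1_tilde.abs_eq)
  moreover have "lambda1 a \<in> aug_coset (lambda1 a)"
    unfolding aug_coset_def
    by (rule image_eqI[of _ _ 0]) (simp_all add: module.subspace_0[OF ring_self subspace_aug_ideal_plus])
  ultimately show "lambda1 a \<in> aug_ideal_plus" by simp
next
  assume a: "lambda1 a \<in> aug_ideal_plus"
  have "j \<in> aug_coset (lambda1 a)" if "j \<in> aug_ideal_plus" for j
    unfolding aug_coset_def
    by (rule image_eqI[of _ _ "j - lambda1 a"])
      (simp_all add: module.subspace_diff[OF ring_self subspace_aug_ideal_plus that a])
  moreover have "aug_coset (lambda1 a) \<subseteq> aug_ideal_plus"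
    using module.subspace_add[OF ring_self subspace_aug_ideal_plus a] by (auto simp: aug_coset_def)
  ultimately have "aug_coset (lambda1 a) = aug_ideal_plus" by blast
  then show "rp_to_rpt a \<in> rpt1"
    by (simp add: rpt1_def rp_to_rpt.abs_eq lambda1_tilde.abs_eq)
qed


lifting_forget rpt.lifting


section \<open>The quotient by \<open>D\<^sub>F\<close>\<close>

text \<open>For fields with at least 4 elements the value does not depend on the choice of \<open>x\<close>.\<close>

definition C_elem :: "'a::field rp"
  where "C_elem =
    (if CARD('a) = 2 then bracket 0
     else if CARD('a) = 3 then psi1 (-1)
     else let x = (SOME x. x \<noteq> 0 \<and> x \<noteq> 1) in
       bracket x + \<langle>-1\<rangle> *\<^sub>R\<^sub>P bracket (1 - x) + \<langle>\<langle>1 - x\<rangle>\<rangle> *\<^sub>R\<^sub>P psi1 x)"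

definition D_elem :: "'a::field rp"
  where "D_elem = C_elem + C_elem"

definition D_sub :: "'a::field rp set"
  where "D_sub = rp.span {D_elem}"

definition rpbar_rel :: "'a::field rpt \<Rightarrow> 'a rpt \<Rightarrow> bool"
  where "rpbar_rel a b \<longleftrightarrow> a - b \<in> rp_to_rpt ` D_sub"

lemma subspace_D_image: "rpt.subspace (rp_to_rpt ` D_sub)"
  by (rule module_hom.subspace_image[OF module_hom_rp_to_rpt]) (simp add: D_sub_def)

quotient_type (overloaded) 'a rpbar = "'a::field rpt" / rpbar_rel
  unfolding rpbar_rel_def by (rule rpt.equivp_subspace) (rule subspace_D_image)

instantiation rpbar :: (field) ab_group_add
begin
lift_definition zero_rpbar :: "'a rpbar" is 0 .
lift_definition plus_rpbar :: "'a rpbar \<Rightarrow> 'a rpbar \<Rightarrow> 'a rpbar"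
  is "(+)" unfolding rpbar_rel_def by (rule rpt.subspace_add_cong[OF subspace_D_image])
lift_definition minus_rpbar :: "'a rpbar \<Rightarrow> 'a rpbar \<Rightarrow> 'a rpbar"
  is "(-)" unfolding rpbar_rel_def by (rule rpt.subspace_diff_cong[OF subspace_D_image])
lift_definition uminus_rpbar :: "'a rpbar \<Rightarrow> 'a rpbar"
  is uminus unfolding rpbar_rel_def by (rule rpt.subspace_uminus_cong[OF subspace_D_image])
instance
  by standard
    (transfer; simp add: rpbar_rel_def rpt.subspace_0[OF subspace_D_image] algebra_simps)+
end

lift_definition rpbar_scale :: "'a::field sqring \<Rightarrow> 'a rpbar \<Rightarrow> 'a rpbar"
  is rpt_scale unfolding rpbar_rel_def by (rule rpt.subspace_scale_cong[OF subspace_D_image])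

interpretation rpbar: module rpbar_scale
  by standard
    (transfer; simp add: rpbar_rel_def rpt.subspace_0[OF subspace_D_image] algebra_simps)+

lift_definition rpt_to_rpbar :: "'a::field rpt \<Rightarrow> 'a rpbar" is "\<lambda>t. t" .

lemma module_hom_rpt_to_rpbar:
  "module_hom rpt_scale rpbar_scale (rpt_to_rpbar :: 'a::field rpt \<Rightarrow> _)"
  by unfold_locales (transfer; simp add: rpbar_rel_def rpt.subspace_0[OF subspace_D_image])+

lemma subspace_rpt1: "rpt.subspace (rpt1 :: 'a::field rpt set)"
proof -
  interpret q: module_hom rp_scale rpt_scale "rp_to_rpt :: 'a rp \<Rightarrow> _" by (rule module_hom_rp_to_rpt)
  have surj: "\<exists>a. t = rp_to_rpt a" for t :: "'a rpt"
    by (induct t rule: rpt.abs_induct) (auto simp: rp_to_rpt.abs_eq)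
  have "(rpt1 :: 'a rpt set) = rp_to_rpt ` (lambda1 -` aug_ideal_plus)"
    using surj rp_to_rpt_in_rpt1_iff by (fastforce simp: image_iff)
  moreover have "rpt.subspace (rp_to_rpt ` (lambda1 -` aug_ideal_plus :: 'a rp set))"
    by (intro q.subspace_image module_hom.subspace_vimage[OF module_hom_lambda1 subspace_aug_ideal_plus])
  ultimately show ?thesis by metis
qed

text \<open>The kernel \<open>rpt1\<close> modulo the image of \<open>D\<^sub>F\<close>, as a submodule of the type \<open>'a rpbar\<close>.\<close>

typedef (overloaded) 'a rpbar1 = "rpt_to_rpbar ` rpt1 :: 'a::field rpbar set"
  morphisms rpbar1_incl Abs_rpbar1
  using rpt.subspace_0[OF subspace_rpt1] by blast

lemma subspace_rpbar1: "rpbar.subspace (rpt_to_rpbar ` rpt1 :: 'a::field rpbar set)"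
  by (rule module_hom.subspace_image[OF module_hom_rpt_to_rpbar subspace_rpt1])

setup_lifting type_definition_rpbar1

instantiation rpbar1 :: (field) ab_group_add
begin
lift_definition zero_rpbar1 :: "'a rpbar1" is 0
  by (rule rpbar.subspace_0[OF subspace_rpbar1])
lift_definition plus_rpbar1 :: "'a rpbar1 \<Rightarrow> 'a rpbar1 \<Rightarrow> 'a rpbar1" is "(+)"
  by (rule rpbar.subspace_add[OF subspace_rpbar1])
lift_definition minus_rpbar1 :: "'a rpbar1 \<Rightarrow> 'a rpbar1 \<Rightarrow> 'a rpbar1" is "(-)"
  by (rule rpbar.subspace_diff[OF subspace_rpbar1])
lift_definition uminus_rpbar1 :: "'a rpbar1 \<Rightarrow> 'a rpbar1" is uminus
  by (rule rpbar.subspace_neg[OF subspace_rpbar1])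
instance by standard (transfer; simp add: algebra_simps)+
end

lemma additive_rpbar1_incl: "additive rpbar1_incl"
  by standard (rule plus_rpbar1.rep_eq)


section \<open>Inverting 2 in \<open>R\<^sub>F\<close> and in the quotient modules\<close>

definition e_plus :: "'a::field sqring loc2"
  where "e_plus = (1 + \<langle>-1\<rangle>) \<otimes>\<^sub>\<int> half"

text \<open>On \<open>R\<^sub>F[1/2]\<close> itself, the action \<open>tensor_act (*)\<close> is the ring multiplication.\<close>

lemma e_plus_idempotent: "tensor_act (*) e_plus e_plus = (e_plus :: 'a::field sqring loc2)"
proof -
  have "(1 + \<langle>-1 :: 'a\<rangle>) * (1 + \<langle>-1\<rangle>) = zscale 2 (1 + \<langle>-1\<rangle>)"
    unfolding zscale_ring by (simp add: distrib_left distrib_right)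
  then have "tensor_act (*) e_plus e_plus = zscale 2 (1 + \<langle>-1 :: 'a\<rangle>) \<otimes>\<^sub>\<int> (half * half)"
    unfolding e_plus_def by (simp only: module.tensor_act_tens[OF ring_self])
  also have "\<dots> = (1 + \<langle>-1\<rangle>) \<otimes>\<^sub>\<int> (2 * half * half)"
    unfolding tens_zscale_left tens_zscale_right[symmetric]
    by (simp only: zscale_ring of_int_numeral mult.assoc)
  finally show ?thesis by (simp only: two_half mult_1 e_plus_def)
qed

text \<open>The map of localizations induced by the inclusion.\<close>

definition rpbar1_loc2_map :: "'a::field rpbar1 loc2 \<Rightarrow> 'a rpbar loc2"
  where "rpbar1_loc2_map = tensor_map rpbar1_incl (\<lambda>q. q)"

lemma inj_rpbar1_loc2_map: "inj rpbar1_loc2_map"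
  unfolding rpbar1_loc2_map_def
  by (rule inj_tensor_map_loc2[OF additive_rpbar1_incl]) (simp add: inj_def rpbar1_incl_inject)

end

theory Submission
  imports Defs
begin

text \<open>
  Let \<open>M\<close> be the part of \<open>\<R>\<P>[1/2]\<close> modulo \<open>K\<^sup>(\<^sup>1\<^sup>)\<close> on which \<open>\<langle>-1\<rangle>\<close> acts as \<open>-1\<close>; the point is that
  \<open>\<lambda>\<^sub>1\<close> is injective on \<open>M\<close>. In \<open>M\<close> one has \<open>[1/x] = [x]\<close>, and comparing the five-term relations of
  \<open>(x, y)\<close> and \<open>(1 - x, 1 - y)\<close> shows that \<open>[x] - [1 - x]\<close> is constant, hence 0. Symmetrizing the
  five-term relation in \<open>x\<close> and \<open>y\<close> gives \<open>\<langle>x\<rangle>[x] = -[x]\<close>, and multiplying it by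
  \<open>\<lambda>\<^sub>1[x] \<lambda>\<^sub>1[y]\<close> then kills its last three terms and leaves \<open>\<lambda>\<^sub>1[y] [x] = \<lambda>\<^sub>1[x] [y]\<close>. So if
  \<open>\<lambda>\<^sub>1 a = 0\<close>, then every \<open>\<lambda>\<^sub>1[y]\<close> kills \<open>a\<close>; but \<open>\<lambda>\<^sub>1[x] [x] = 4 [x]\<close>, so \<open>a\<close> is killed by a
  product of elements \<open>4 - \<lambda>\<^sub>1[x]\<close>, hence by a power of 2.
\<close>

section \<open>Modules over \<open>R\<close> after inverting 2\<close>

lemma module_tensor_act:
  assumes "module s"
  shows "module (\<lambda>r. tensor_act s (r \<otimes>\<^sub>\<int> (1 :: 'z::comm_ring_1)))"
proof -
  interpret module s by fact
  show ?thesis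
  proof
    fix a b :: 'a and x y :: "('b, 'z) tensor"
    show "tensor_act s (a \<otimes>\<^sub>\<int> 1) (x + y) = tensor_act s (a \<otimes>\<^sub>\<int> 1) x + tensor_act s (a \<otimes>\<^sub>\<int> 1) y"
      by (rule tensor_act_add_right)
    show "tensor_act s ((a + b) \<otimes>\<^sub>\<int> 1) x = tensor_act s (a \<otimes>\<^sub>\<int> 1) x + tensor_act s (b \<otimes>\<^sub>\<int> 1) x"
      by (simp add: tens_add_left tensor_act_add_left)
    show "tensor_act s (a \<otimes>\<^sub>\<int> 1) (tensor_act s (b \<otimes>\<^sub>\<int> 1) x) = tensor_act s ((a * b) \<otimes>\<^sub>\<int> 1) x"
      by (induction x rule: tensor_induct) (simp_all add: tensor_act_tens tensor_act_add_right)
    show "tensor_act s (1 \<otimes>\<^sub>\<int> 1) x = x"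
      by (induction x rule: tensor_induct) (simp_all add: tensor_act_tens tensor_act_add_right)
  qed
qed

text \<open>Acting by \<open>half\<close> in the second factor undoes doubling.\<close>

lemma loc2_double_eq_0:
  assumes "x + x = (0 :: 'b::ab_group_add loc2)"
  shows "x = 0"
proof -
  have "tensor_act zscale (1 \<otimes>\<^sub>\<int> half) (x + x) = x"
  proof (induction x rule: tensor_induct)
    case (tens a b)
    have "half * (b + b) = b"
      by (simp only: distrib_left distrib_right[symmetric] half_add_half mult_1)
    then show ?case
      by (simp only: zmod.tensor_act_add_right zmod.tensor_act_tens zmod.scale_one
          tens_add_right[symmetric])
  next
    case (add t u)
    then show ?case by (simp add: zmod.tensor_act_add_right algebra_simps)
  qed
  moreover have "tensor_act zscale (1 \<otimes>\<^sub>\<int> half) (0 :: 'b loc2) = 0"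
    using zmod.tensor_act_add_right[of "1 \<otimes>\<^sub>\<int> half" 0 "0 :: 'b loc2"] by simp
  ultimately show ?thesis using assms by simp
qed

lemma sq_self_left [simp]: "\<langle>x\<rangle> * (\<langle>x\<rangle> * r) = (r :: 'a::field sqring)"
  by (simp add: mult.assoc[symmetric])

section \<open>Symbols negated by the class of -1\<close>

text \<open>Abstracts the images of the \<open>[x]\<close> in the part where
  \<open>\<langle>-1\<rangle>\<close> acts as -1. The invertibility of 2 enters only as
  \<open>double_eq_0\<close>; the value at 0 is a convention.\<close>

locale minus_symbols = module scale
  for scale :: "'a::field sqring \<Rightarrow> 'm::ab_group_add \<Rightarrow> 'm"  (infixr \<open>*s\<close> 75) +
  fixes b :: "'a \<Rightarrow> 'm"
  assumes double_eq_0: "u + u = 0 \<Longrightarrow> u = (0 :: 'm)"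
    and scale_minus_one_b: "\<langle>-1\<rangle> *s b x = - b x"
    and b_0 [simp]: "b 0 = 0"
    and b_1 [simp]: "b 1 = 0"
    and b_inverse: "x \<noteq> 0 \<Longrightarrow> b (inverse x) = b x"
    and five_term_b: "\<lbrakk>x \<noteq> 0; x \<noteq> 1; y \<noteq> 0; y \<noteq> 1\<rbrakk> \<Longrightarrow>
      b x - b y + \<langle>x\<rangle> *s b (y / x) - \<langle>inverse x - 1\<rangle> *s b ((1 - inverse x) / (1 - inverse y))
        + \<langle>1 - x\<rangle> *s b ((1 - x) / (1 - y)) = 0"
begin

lemma self_neg_eq_0: "u = - u \<Longrightarrow> u = (0 :: 'm)"
  by (rule double_eq_0) (metis add.right_inverse)

lemma b_divide_swap: "x \<noteq> 0 \<Longrightarrow> y \<noteq> 0 \<Longrightarrow> b (x / y) = b (y / x)"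
  using b_inverse[of "x / y"] by simp

text \<open>With \<open>u = y / x\<close> and \<open>v = (1 - x) / (1 - y)\<close>, the last three
  symbols are those of \<open>u\<close>, \<open>u * v\<close> and \<open>v\<close>. This form shows
  the symmetries of the relation.\<close>

lemma five_term_b':
  assumes "x \<noteq> 0" "x \<noteq> 1" "y \<noteq> 0" "y \<noteq> 1"
  shows "b x - b y + \<langle>x\<rangle> *s b (y / x) - (\<langle>x\<rangle> * \<langle>1 - x\<rangle>) *s b ((y / x) * ((1 - x) / (1 - y)))
    + \<langle>1 - x\<rangle> *s b ((1 - x) / (1 - y)) = 0"
proof -
  have "inverse x - 1 = (1 - x) / x" using assms by (simp add: field_simps)
  then have "\<langle>inverse x - 1\<rangle> = \<langle>x\<rangle> * \<langle>1 - x\<rangle>"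
    using assms by (simp add: sq_divide mult.commute)
  moreover have "(1 - inverse x) / (1 - inverse y) = (y / x) * ((1 - x) / (1 - y))"
  proof -
    have "1 - inverse x = - ((1 - x) / x)" "1 - inverse y = - ((1 - y) / y)"
      using assms by (simp_all add: divide_inverse algebra_simps)
    then show ?thesis by simp
  qed
  ultimately show ?thesis using five_term_b[OF assms] by simp
qed

section \<open>Symmetries of the symbols and the square classes acting on them\<close>

lemma b_one_minus: "b (1 - x) = b x"
proof (cases "x = 0 \<or> x = 1")
  case False
  have const: "b x - b (1 - x) = b y - b (1 - y)"
    if "x \<noteq> 0" "x \<noteq> 1" "y \<noteq> 0" "y \<noteq> 1" for x y
  proof -
    have swap: "b ((1 - y) / (1 - x)) = b ((1 - x) / (1 - y))"
      "b (x / y) = b (y / x)"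
      "b (x * (1 - y) / (y * (1 - x))) = b (y * (1 - x) / (x * (1 - y)))"
      using that by (auto intro!: b_divide_swap)
    \<comment> \<open>Passing to \<open>(1 - x, 1 - y)\<close> inverts and exchanges
      \<open>u\<close> and \<open>v\<close>; as \<open>b\<close> ignores inversion, the last three
      terms of the relation are only permuted.\<close>
    have "b (1 - x) - b (1 - y) + \<langle>1 - x\<rangle> *s b ((1 - x) / (1 - y))
        - (\<langle>x\<rangle> * \<langle>1 - x\<rangle>) *s b ((y / x) * ((1 - x) / (1 - y))) + \<langle>x\<rangle> *s b (y / x) = 0"
      using five_term_b'[of "1 - x" "1 - y"] that
      by (simp add: swap mult.commute)
    moreover have "p - p' = q - q'"
      if "p - q + r - s + t = 0" "p' - q' + t - s + r = 0" for p q r s t p' q' :: 'm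
    proof -
      have "(p - p') - (q - q') = (p - q + r - s + t) - (p' - q' + t - s + r)"
        by (simp add: algebra_simps)
      with that show ?thesis by simp
    qed
    ultimately show ?thesis using five_term_b'[OF that] by blast
  qed
  \<comment> \<open>At \<open>1 - x\<close> the constant takes the negative of its value at
    \<open>x\<close>.\<close>
  have "b x - b (1 - x) = b (1 - x) - b x"
    using const[of x "1 - x"] False by simp
  then have "b x - b (1 - x) = 0" by (intro self_neg_eq_0) simp
  then show ?thesis by simp
qed auto

text \<open>The sum of the five-term relations of \<open>(x, y)\<close> and \<open>(y, x)\<close>, written in terms of \<open>u = y/x\<close>
  and \<open>v = (1 - x)/(1 - y)\<close>, is the cocycle relation \<open>h_mult\<close>. Taking \<open>v = -1\<close> there makes
  \<open>h\<close> vanish.\<close>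

definition h :: "'a \<Rightarrow> 'm"
  where "h u = (\<langle>u - 1\<rangle> * (1 + \<langle>u\<rangle>)) *s b u"

lemma scale_h: "\<langle>u\<rangle> *s h u = h u"
  by (simp add: h_def algebra_simps)

lemma h_mult:
  assumes "u \<noteq> 0" "u \<noteq> 1" "v \<noteq> 0" "v \<noteq> 1" "u * v \<noteq> 1"
  shows "h u + \<langle>v\<rangle> *s h v = \<langle>v\<rangle> *s h (u * v)"
proof -
  \<comment> \<open>The solution of \<open>y / x = u\<close> and
    \<open>(1 - x) / (1 - y) = v\<close>.\<close>
  define x where "x = (v - 1) / (u * v - 1)"
  define y where "y = u * x"
  have x: "x \<noteq> 0" "1 - x = v * (u - 1) / (u * v - 1)"
    and y: "y \<noteq> 0" "1 - y = (u - 1) / (u * v - 1)"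
    using assms by (auto simp: x_def y_def field_simps)
  have ne: "1 - x \<noteq> 0" "1 - y \<noteq> 0"
    using assms unfolding x(2) y(2) by auto
  have u: "y / x = u" "(1 - x) / (1 - y) = v"
    using x(1) assms unfolding x(2) y(2) by (auto simp: y_def)
  define U V W where "U = \<langle>u - 1\<rangle>" "V = \<langle>v - 1\<rangle>" "W = \<langle>u * v - 1\<rangle>"
  note defs = this
  have sx: "\<langle>x\<rangle> = V * W" "\<langle>1 - x\<rangle> = \<langle>v\<rangle> * U * W" "\<langle>y\<rangle> = \<langle>u\<rangle> * V * W" "\<langle>1 - y\<rangle> = U * W"
    using assms x(1) unfolding x(2) y(2)
    by (simp_all add: y_def sq_mult) (simp_all add: x_def sq_mult sq_divide defs)
  have swap: "b (x / y) = b u" "b ((1 - y) / (1 - x)) = b v"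
      "b (x / y * ((1 - y) / (1 - x))) = b (u * v)"
  proof -
    have "x / y = inverse u" "(1 - y) / (1 - x) = inverse v"
      unfolding u[symmetric] by simp_all
    then show "b (x / y) = b u" "b ((1 - y) / (1 - x)) = b v"
      "b (x / y * ((1 - y) / (1 - x))) = b (u * v)"
      using assms b_inverse[of "u * v"] b_inverse[of u] b_inverse[of v]
      by (simp_all add: mult.commute)
  qed
  have r: "b x - b y + (V * W) *s b u - (V * W * (\<langle>v\<rangle> * U * W)) *s b (u * v)
      + (\<langle>v\<rangle> * U * W) *s b v = 0"
    using five_term_b'[of x y] x(1) y(1) ne u sx by simp
  have r': "b y - b x + (\<langle>u\<rangle> * V * W) *s b u - (\<langle>u\<rangle> * V * W * (U * W)) *s b (u * v)
      + (U * W) *s b v = 0"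
    using five_term_b'[of y x] x(1) y(1) ne swap sx by simp
  have "(V * W) *s b u + (\<langle>u\<rangle> * V * W) *s b u + ((\<langle>v\<rangle> * U * W) *s b v + (U * W) *s b v)
      - ((V * W * (\<langle>v\<rangle> * U * W)) *s b (u * v) + (\<langle>u\<rangle> * V * W * (U * W)) *s b (u * v)) = 0"
    using arg_cong2[OF r r', of "(+)"] by (simp add: algebra_simps)
  \<comment> \<open>Since \<open>U\<close>, \<open>V\<close> and \<open>W\<close> square to 1, this
    multiplier turns the three coefficients into those occurring in \<open>h\<close>.\<close>
  then have "(U * V * W) *s ((V * W + \<langle>u\<rangle> * V * W) *s b u + (\<langle>v\<rangle> * U * W + U * W) *s b v
      - (V * W * (\<langle>v\<rangle> * U * W) + \<langle>u\<rangle> * V * W * (U * W)) *s b (u * v)) = 0"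
    by (simp add: scale_left_distrib)
  moreover have "U * V * W * (V * W + \<langle>u\<rangle> * V * W) = U * (1 + \<langle>u\<rangle>)"
    "U * V * W * (\<langle>v\<rangle> * U * W + U * W) = \<langle>v\<rangle> * (V * (1 + \<langle>v\<rangle>))"
    "U * V * W * (V * W * (\<langle>v\<rangle> * U * W) + \<langle>u\<rangle> * V * W * (U * W))
      = \<langle>v\<rangle> * (W * (1 + \<langle>u * v\<rangle>))"
    using assms unfolding defs by (simp_all add: algebra_simps sq_mult)
  ultimately show ?thesis
    by (simp add: h_def defs scale_right_diff_distrib scale_right_distrib)
qed

lemma scale_minus_one_h: "\<langle>-1\<rangle> *s h u = - h u"
  unfolding h_def by (subst scale_left_commute) (simp only: scale_minus_one_b scale_minus_right)

lemma h_eq_0: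
  assumes "u \<noteq> 0" "u \<noteq> 1"
  shows "h u = 0"
proof (cases "u = -1 \<or> (1 :: 'a) = -1")
  \<comment> \<open>For \<open>u = -1\<close>, \<open>\<langle>u\<rangle>\<close> both fixes and
    negates \<open>h u\<close>; in characteristic 2, \<open>\<langle>-1\<rangle> = 1\<close> already
    negates it.\<close>
  case True
  then have "\<langle>u\<rangle> *s h u = - h u \<or> h u = - h u"
    using scale_minus_one_h[of u] by (metis scale_one sq_one)
  then show ?thesis using scale_h[of u] self_neg_eq_0 by metis
next
  case False
  then have "- u \<noteq> 1" by (metis minus_minus)
  have "h (-1) = 0"
    using scale_h[of "-1"] scale_minus_one_h[of "-1"] self_neg_eq_0 by metis
  \<comment> \<open>The cocycle relation at \<open>v = -1\<close> gives this sign; below, the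
    invariance of \<open>h\<close> under its own class gives the opposite one.\<close>
  then have neg: "h u = - h (- u)"
    using h_mult[of u "-1"] False assms \<open>- u \<noteq> 1\<close> by (simp add: scale_minus_one_h)
  have "\<langle>- u\<rangle> = \<langle>-1\<rangle> * \<langle>u\<rangle>"
    using sq_mult[of "-1" u] assms by simp
  then have "h (- u) = \<langle>-1\<rangle> *s \<langle>u\<rangle> *s h (- u)"
    using scale_h[of "- u"] by simp
  also have "\<langle>u\<rangle> *s h (- u) = - h u"
    using neg scale_h[of u] by (metis minus_minus scale_minus_right)
  finally have "h (- u) = h u" by (simp add: scale_minus_one_h)
  with neg show ?thesis using self_neg_eq_0 by metis
qed

lemma scale_b: "\<langle>x\<rangle> *s b x = - b x"
proof (cases "x = 0 \<or> x = 1")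
  case False
  \<comment> \<open>A square class is its own inverse, so this cancels the leading factor of
    \<open>h\<close>.\<close>
  then have "\<langle>x - 1\<rangle> *s h x = 0" by (simp add: h_eq_0)
  then have "b x + \<langle>x\<rangle> *s b x = 0" by (simp add: h_def scale_left_distrib)
  then show ?thesis by (simp add: eq_neg_iff_add_eq_0 add.commute)
qed auto

lemma scale_one_minus_b: "\<langle>1 - x\<rangle> *s b x = - b x"
  using scale_b[of "1 - x"] by (simp add: b_one_minus)

section \<open>Values of \<lambda>_1 as operators on the symbols\<close>

text \<open>\<open>\<langle>x\<rangle>\<close> and \<open>\<langle>1 - x\<rangle>\<close> act as -1
  on \<open>b x\<close>, so both Pfister factors act as -2.\<close>

lemma lambda1_gen_scale_b: "lambda1_gen x *s b x = 4 *s b x"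
proof (cases "x = 0 \<or> x = 1")
  case False
  have "\<langle>\<langle>x\<rangle>\<rangle> *s b x = (- 2) *s b x" "\<langle>\<langle>1 - x\<rangle>\<rangle> *s b x = (- 2) *s b x"
  proof -
    have "(- 2) *s b x = - b x - b x"
      using scale_left_distrib[of "- 1" "- 1" "b x"] by simp
    then show "\<langle>\<langle>x\<rangle>\<rangle> *s b x = (- 2) *s b x" "\<langle>\<langle>1 - x\<rangle>\<rangle> *s b x = (- 2) *s b x"
      by (simp_all add: pfister_def scale_left_diff_distrib scale_b scale_one_minus_b)
  qed
  then have "\<langle>\<langle>1 - x\<rangle>\<rangle> *s \<langle>\<langle>x\<rangle>\<rangle> *s b x = (- 2) *s (- 2) *s b x"
    by (metis scale_left_commute)
  with False show ?thesis by (simp add: lambda1_gen_def)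
qed (auto simp: lambda1_gen_def)

lemma two_power_scale_eq_0: "2 ^ n *s u = 0 \<Longrightarrow> u = 0"
proof (induction n)
  case (Suc n)
  have "2 ^ Suc n *s u = 2 ^ n *s u + 2 ^ n *s u"
    by (simp only: power_Suc mult_2 scale_left_distrib)
  with Suc show ?case using double_eq_0 by metis
qed simp

lemma lambda1_gen_scale_swap: "lambda1_gen x *s b y = lambda1_gen y *s b x"
proof (cases "x = 0 \<or> x = 1 \<or> y = 0 \<or> y = 1")
  case False
  define L where "L = lambda1_gen x * lambda1_gen y"
  \<comment> \<open>Each class negates its Pfister factor in \<open>L\<close>:
    \<open>\<langle>z\<rangle> * \<langle>\<langle>z\<rangle>\<rangle> = -
    \<langle>\<langle>z\<rangle>\<rangle>\<close>.\<close>
  have L: "L * \<langle>x\<rangle> = - L" "L * \<langle>y\<rangle> = - L" "L * \<langle>1 - x\<rangle> = - L" "L * \<langle>1 - y\<rangle> = - L"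
    using False by (simp_all add: L_def lambda1_gen_def pfister_def algebra_simps)
  \<comment> \<open>\<open>L\<close> absorbs \<open>\<langle>t\<rangle>\<close>, which negates
    \<open>b t\<close>.\<close>
  have kill: "L *s b t = 0" if "L * \<langle>t\<rangle> = L" for t
  proof -
    have "L *s b t = L *s \<langle>t\<rangle> *s b t" by (simp add: that)
    also have "\<dots> = - (L *s b t)" by (simp add: scale_b)
    finally show ?thesis by (rule self_neg_eq_0)
  qed
  have kill': "(L * r) *s b t = 0" if "L * \<langle>t\<rangle> = L" for t r
    using kill[OF that] by (metis mult.commute scale_scale scale_zero_right)
  \<comment> \<open>The arguments of the last three terms are quotients of elements whose classes
    negate \<open>L\<close>, or products of such quotients; the two signs in each quotient
    cancel.\<close>
  have q1: "L * \<langle>y / x\<rangle> = L" "L * \<langle>(1 - x) / (1 - y)\<rangle> = L"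
    using False L by (simp_all add: sq_divide mult.assoc[symmetric])
  moreover have "L * \<langle>(y / x) * ((1 - x) / (1 - y))\<rangle> = L"
    using False q1 by (subst sq_mult) (simp_all add: mult.assoc[symmetric])
  ultimately have "L *s (b x - b y) = 0"
    using arg_cong[OF five_term_b'[of x y], of "(*s) L"] False
    by (simp add: scale_right_distrib scale_right_diff_distrib kill')
  moreover have "L *s b x = 4 *s (lambda1_gen y *s b x)"
    unfolding L_def by (metis lambda1_gen_scale_b mult.commute scale_scale)
  moreover have "L *s b y = 4 *s (lambda1_gen x *s b y)"
    unfolding L_def by (metis lambda1_gen_scale_b mult.commute scale_scale)
  ultimately have "2 ^ 2 *s (lambda1_gen x *s b y - lambda1_gen y *s b x) = 0"
    by (simp add: scale_right_diff_distrib)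
  then have "lambda1_gen x *s b y - lambda1_gen y *s b x = 0" by (rule two_power_scale_eq_0)
  then show ?thesis by simp
qed (auto simp: lambda1_gen_def)

theorem free_lift_b_eq_0:
  assumes "free_lift (*) lambda1_gen f = 0"
  shows "free_lift (*s) b f = 0"
proof -
  \<comment> \<open>Both sides are linear in \<open>f\<close>, and on generators this is
    \<open>lambda1_gen_scale_swap\<close>.\<close>
  have "lambda1_gen y *s free_lift (*s) b f = free_lift (*) lambda1_gen f *s b y" for y f
  proof (induction f rule: poly_mapping_add_induct)
    case (single k n)
    show ?case
      unfolding free_lift_single module.free_lift_single[OF ring_self]
      by (metis lambda1_gen_scale_swap scale_left_commute scale_scale)
  qed (simp add: free_lift_add module.free_lift_add[OF ring_self] scale_right_distrib
      scale_left_distrib)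
  then have ann: "lambda1_gen y *s free_lift (*s) b f = 0" for y by (simp add: assms)
  \<comment> \<open>\<open>s\<close> is a product of factors \<open>4 - lambda1_gen k\<close>: each
    kills the term at its generator \<open>k\<close> and acts as 4 on anything that all
    \<open>lambda1_gen y\<close> annihilate.\<close>
  have "\<exists>s n. s *s free_lift (*s) b f = 0
      \<and> (\<forall>d. (\<forall>y. lambda1_gen y *s d = 0) \<longrightarrow> s *s d = 2 ^ n *s d)" for f
  proof (induction f rule: poly_mapping_add_induct)
    case (single k r)
    have "(4 - lambda1_gen k) *s r *s b k = 0"
      by (subst scale_left_commute) (simp add: scale_left_diff_distrib lambda1_gen_scale_b)
    then show ?case
      by (intro exI[of _ "4 - lambda1_gen k"] exI[of _ 2])
        (simp add: free_lift_single scale_left_diff_distrib)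
  next
    case (sum f g)
    then obtain s m t n where f: "s *s free_lift (*s) b f = 0" and g: "t *s free_lift (*s) b g = 0"
      and s: "\<And>d. \<forall>y. lambda1_gen y *s d = 0 \<Longrightarrow> s *s d = 2 ^ m *s d"
      and t: "\<And>d. \<forall>y. lambda1_gen y *s d = 0 \<Longrightarrow> t *s d = 2 ^ n *s d" by metis
    have "(s * t) *s free_lift (*s) b (f + g) = t *s s *s free_lift (*s) b f + s *s t *s free_lift (*s) b g"
      by (simp add: free_lift_add scale_right_distrib mult.commute)
    then have "(s * t) *s free_lift (*s) b (f + g) = 0" by (simp only: f g scale_zero_right add_0)
    moreover have "(s * t) *s d = 2 ^ (m + n) *s d" if d: "\<forall>y. lambda1_gen y *s d = 0" for d
    proof -
      have "(s * t) *s d = s *s 2 ^ n *s d" by (simp add: t[OF d, symmetric])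
      also have "\<dots> = 2 ^ n *s 2 ^ m *s d" by (subst scale_left_commute) (simp only: s[OF d])
      finally show ?thesis by (simp add: power_add mult.commute)
    qed
    ultimately show ?case by blast
  qed
  then obtain n where "2 ^ n *s free_lift (*s) b f = 0" using ann by metis
  then show ?thesis by (rule two_power_scale_eq_0)
qed

end

section \<open>Projection from the scissors congruence group to its quotient\<close>

definition rp_to_rpbar :: "'a::field rp \<Rightarrow> 'a rpbar"
  where "rp_to_rpbar a = rpt_to_rpbar (rp_to_rpt a)"

interpretation rp_to_rpbar: module_hom rp_scale rpbar_scale "rp_to_rpbar :: 'a::field rp \<Rightarrow> _"
  using module_hom_compose[OF module_hom_rp_to_rpt module_hom_rpt_to_rpbar]
  unfolding rp_to_rpbar_def comp_def .

lemma rp_to_rpbar_surj: obtains a where "t = rp_to_rpbar a"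
proof -
  obtain t' where "t = rpt_to_rpbar t'"
    by (induct t rule: rpbar.abs_induct) (auto simp: rpt_to_rpbar.abs_eq)
  moreover obtain a where "t' = rp_to_rpt a"
    by (induct t' rule: rpt.abs_induct) (auto simp: rp_to_rpt.abs_eq)
  ultimately show ?thesis using that by (simp add: rp_to_rpbar_def)
qed

text \<open>Reduces membership in the submodule to a condition on \<lambda>_1 of a
  representative.\<close>

lemma range_rpbar1_incl:
  "range rpbar1_incl = rp_to_rpbar ` (lambda1 -` aug_ideal_plus :: 'a::field rp set)"
proof -
  have surj: "\<exists>a. t = rp_to_rpt a" for t :: "'a rpt"
    by (induct t rule: rpt.abs_induct) (auto simp: rp_to_rpt.abs_eq)
  have "rp_to_rpbar ` (lambda1 -` aug_ideal_plus :: 'a rp set) = rpt_to_rpbar ` rpt1"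
  proof
    show "rpt_to_rpbar ` rpt1 \<subseteq> rp_to_rpbar ` (lambda1 -` aug_ideal_plus :: 'a rp set)"
    proof clarify
      fix t :: "'a rpt" assume "t \<in> rpt1"
      moreover obtain a where "t = rp_to_rpt a" using surj by blast
      ultimately show "rpt_to_rpbar t \<in> rp_to_rpbar ` (lambda1 -` aug_ideal_plus)"
        by (auto simp: rp_to_rpt_in_rpt1_iff rp_to_rpbar_def)
    qed
  qed (auto simp: rp_to_rpt_in_rpt1_iff rp_to_rpbar_def)
  then show ?thesis
    using type_definition.Rep_range[OF type_definition_rpbar1] by simp
qed

lemma abs_rp_scale: "abs_rp (free_scale r f) = r *\<^sub>R\<^sub>P abs_rp f"
  by (simp add: rp_scale.abs_eq)

lemma abs_rp_single: "abs_rp (Poly_Mapping.single k r) = r *\<^sub>R\<^sub>P bracket k"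
proof -
  have "Poly_Mapping.single k r = free_scale r (free_bracket k)"
    by (rule poly_mapping_eqI) (simp add: lookup_single when_def)
  then show ?thesis by (simp add: abs_rp_scale bracket.abs_eq)
qed

lemma abs_rp_rels: "f \<in> rp_rels \<Longrightarrow> abs_rp f = 0"
  by (simp add: zero_rp.abs_eq rp.abs_eq_iff rp_rel_def free.span_base)

lemma bracket_1: "bracket 1 = (0 :: 'a::field rp)"
  unfolding bracket.abs_eq by (rule abs_rp_rels) (simp add: rp_rels_def)

lemma bracket_0: "CARD('a) \<noteq> 2 \<Longrightarrow> bracket 0 = (0 :: 'a::field rp)"
  unfolding bracket.abs_eq by (rule abs_rp_rels) (simp add: rp_rels_def)

text \<open>Valid for small fields too: if \<open>x = y\<close>, everything cancels or is a multiple
  of \<open>bracket 1\<close>; otherwise 0, 1, \<open>x\<close>, \<open>y\<close> are four elements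
  and the relation is a defining one.\<close>

lemma bracket_five_term:
  fixes x y :: "'a::field"
  assumes "x \<noteq> 0" "x \<noteq> 1" "y \<noteq> 0" "y \<noteq> 1"
  shows "bracket x - bracket y + \<langle>x\<rangle> *\<^sub>R\<^sub>P bracket (y / x)
    - \<langle>inverse x - 1\<rangle> *\<^sub>R\<^sub>P bracket ((1 - inverse x) / (1 - inverse y))
    + \<langle>1 - x\<rangle> *\<^sub>R\<^sub>P bracket ((1 - x) / (1 - y)) = 0"
proof (cases "x = y")
  case True
  then show ?thesis using assms by (simp add: bracket_1)
next
  case False
  then have "card {0, 1, x, y} = 4" using assms by simp
  then have "CARD('a) \<noteq> 2" "CARD('a) \<noteq> 3"
    by (metis card_mono[of UNIV "{0, 1, x, y}"] card.infinite subset_UNIV numeral_le_iff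
        semiring_norm(69,71-73) zero_neq_numeral)+
  then have "five_term x y \<in> rp_rels"
    using assms by (auto simp: rp_rels_def)
  then have "abs_rp (five_term x y) = 0" by (rule abs_rp_rels)
  then show ?thesis
    by (simp add: five_term_def bracket.abs_eq rp_scale.abs_eq plus_rp.abs_eq minus_rp.abs_eq)
qed

lemma rp_to_rpbar_psi1: "x \<noteq> 0 \<Longrightarrow> rp_to_rpbar (psi1 x) = 0"
proof -
  assume "x \<noteq> 0"
  then have "psi1 x \<in> K1" unfolding K1_def by (intro rp.span_base) simp
  then have "rp_to_rpt (psi1 x) = 0"
    by (simp add: rp_to_rpt.abs_eq zero_rpt.abs_eq rpt.abs_eq_iff rpt_rel_def)
  then show ?thesis
    by (simp add: rp_to_rpbar_def module_hom.zero[OF module_hom_rpt_to_rpbar])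
qed

section \<open>The anti-invariant part of the localized quotient\<close>

definition loc2_scale :: "'a::field sqring \<Rightarrow> 'a rpbar loc2 \<Rightarrow> 'a rpbar loc2"
  where "loc2_scale r = tensor_act rpbar_scale (r \<otimes>\<^sub>\<int> 1)"

text \<open>The factor \<open>1 - \<langle>-1\<rangle>\<close> is twice the projector to the part
  where \<open>\<langle>-1\<rangle>\<close> acts as -1.\<close>

definition minus_bracket :: "'a::field \<Rightarrow> 'a rpbar loc2"
  where "minus_bracket x = rp_to_rpbar ((1 - \<langle>-1\<rangle>) *\<^sub>R\<^sub>P bracket x) \<otimes>\<^sub>\<int> 1"

lemma loc2_scale_tens: "loc2_scale r (m \<otimes>\<^sub>\<int> q) = rpbar_scale r m \<otimes>\<^sub>\<int> q"
  by (simp add: loc2_scale_def rpbar.tensor_act_tens)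

lemma rp_to_rpbar_tens_additive: "additive (\<lambda>a. rp_to_rpbar a \<otimes>\<^sub>\<int> q)"
  by standard (simp add: rp_to_rpbar.add tens_add_left)

lemma loc2_scale_rp_to_rpbar: "loc2_scale r (rp_to_rpbar a \<otimes>\<^sub>\<int> q) = rp_to_rpbar (r *\<^sub>R\<^sub>P a) \<otimes>\<^sub>\<int> q"
  by (simp add: loc2_scale_tens rp_to_rpbar.scale)

interpretation minus: minus_symbols loc2_scale "minus_bracket :: 'a::field \<Rightarrow> _"
proof -
  interpret module "loc2_scale :: 'a sqring \<Rightarrow> _"
    unfolding loc2_scale_def by (rule module_tensor_act) (rule rpbar.module_axioms)
  let ?b = "minus_bracket :: 'a \<Rightarrow> _"
  let ?p = "\<lambda>a :: 'a rp. rp_to_rpbar a \<otimes>\<^sub>\<int> (1 :: zhalf)"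
  interpret p: additive ?p by (rule rp_to_rpbar_tens_additive)
  have b: "?b x = loc2_scale (1 - \<langle>-1\<rangle>) (?p (bracket x))" for x
    by (simp add: minus_bracket_def loc2_scale_rp_to_rpbar)
  have neg: "loc2_scale \<langle>-1\<rangle> (?b x) = - ?b x" for x
  proof -
    have "\<langle>-1 :: 'a\<rangle> * (1 - \<langle>-1\<rangle>) = - (1 - \<langle>-1\<rangle>)" by (simp add: algebra_simps)
    then show ?thesis by (simp add: b scale_minus_left[symmetric])
  qed
  show "minus_symbols loc2_scale ?b"
  proof
    show "u = 0" if "u + u = 0" for u :: "'a rpbar loc2"
      using that by (rule loc2_double_eq_0)
    show "loc2_scale \<langle>-1\<rangle> (?b x) = - ?b x" for x by (rule neg)
    have p0: "(0 :: 'a rpbar) \<otimes>\<^sub>\<int> (1 :: zhalf) = 0" using p.zero by simp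
    show "?b 1 = 0" by (simp add: b bracket_1 p0)
    show "?b 0 = 0"
    \<comment> \<open>Over two elements \<open>bracket 0\<close> is the generator of order 3, but
      there \<open>-1 = 1\<close> and the factor \<open>1 - \<langle>-1\<rangle>\<close>
      vanishes.\<close>
    proof (cases "CARD('a) = 2")
      case True
      then have "card {0 :: 'a, 1} = CARD('a)" "finite (UNIV :: 'a set)"
        by (auto intro: card_ge_0_finite)
      then have "{0 :: 'a, 1} = UNIV" by (intro card_subset_eq) auto
      then have "(-1 :: 'a) = 1" by (metis UNIV_I insertE neg_equal_0_iff_equal singletonD zero_neq_one)
      then have "1 - \<langle>-1 :: 'a\<rangle> = 0" by (simp only: sq_one diff_self)
      then show ?thesis by (simp only: b scale_zero_left)
    qed (simp add: b bracket_0 p0)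
    show "?b (inverse x) = ?b x" if "x \<noteq> 0" for x
    proof -
      have "?p (psi1 x) = 0" using rp_to_rpbar_psi1[OF that] p.zero by simp
      then have "loc2_scale (1 - \<langle>-1\<rangle>) (?p (bracket x) + loc2_scale \<langle>-1\<rangle> (?p (bracket (inverse x)))) = 0"
        by (simp add: psi1_def p.add loc2_scale_rp_to_rpbar)
      then have "?b x + loc2_scale \<langle>-1\<rangle> (?b (inverse x)) = 0"
        by (simp add: b scale_right_distrib mult.commute)
      then show ?thesis by (simp add: neg)
    qed
    show "?b x - ?b y + loc2_scale \<langle>x\<rangle> (?b (y / x))
        - loc2_scale \<langle>inverse x - 1\<rangle> (?b ((1 - inverse x) / (1 - inverse y)))
        + loc2_scale \<langle>1 - x\<rangle> (?b ((1 - x) / (1 - y))) = 0"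
      if "x \<noteq> 0" "x \<noteq> 1" "y \<noteq> 0" "y \<noteq> 1" for x y
    proof -
      have "loc2_scale (1 - \<langle>-1\<rangle>) (?p (bracket x - bracket y + \<langle>x\<rangle> *\<^sub>R\<^sub>P bracket (y / x)
          - \<langle>inverse x - 1\<rangle> *\<^sub>R\<^sub>P bracket ((1 - inverse x) / (1 - inverse y))
          + \<langle>1 - x\<rangle> *\<^sub>R\<^sub>P bracket ((1 - x) / (1 - y)))) = 0"
        unfolding bracket_five_term[OF that] by (simp add: p0)
      then show ?thesis
        by (simp only: p.add p.diff loc2_scale_rp_to_rpbar[symmetric] scale_right_distrib
            scale_right_diff_distrib b scale_scale mult.commute)
    qed
  qed
qed

text \<open>On representatives in the free module this is \<open>free_lift_b_eq_0\<close>: lifting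
  \<open>minus_bracket\<close> gives the left-hand side, lifting \<open>lambda1_gen\<close> gives
  \<open>lambda1\<close>.\<close>

lemma minus_part_eq_0:
  fixes a :: "'a::field rp"
  assumes "lambda1 a = 0"
  shows "rp_to_rpbar ((1 - \<langle>-1\<rangle>) *\<^sub>R\<^sub>P a) \<otimes>\<^sub>\<int> 1 = (0 :: 'a rpbar loc2)"
proof -
  have lift: "rp_to_rpbar ((1 - \<langle>-1\<rangle>) *\<^sub>R\<^sub>P abs_rp f) \<otimes>\<^sub>\<int> 1 = free_lift loc2_scale minus_bracket f"
    for f :: "'a \<Rightarrow>\<^sub>0 'a sqring"
  proof (induction f rule: poly_mapping_add_induct)
    case (single k r)
    show ?case
      by (simp add: abs_rp_single minus.free_lift_single minus_bracket_def loc2_scale_rp_to_rpbar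
          mult.commute)
  next
    case (sum f g)
    then show ?case
      by (simp add: plus_rp.abs_eq[symmetric] rp.scale_right_distrib rp_to_rpbar.add tens_add_left
          minus.free_lift_add)
  qed
  obtain f where a: "a = abs_rp f" by (induct a rule: rp.abs_induct) auto
  show ?thesis
    unfolding a lift using assms by (intro minus.free_lift_b_eq_0) (simp add: a lambda1.abs_eq)
qed

text \<open>\<open>1 - \<langle>-1\<rangle>\<close> kills \<open>1 + \<langle>-1\<rangle>\<close>,
  so \<open>minus_part_eq_0\<close> applies to \<open>a\<close> multiplied by
  \<open>1 - \<langle>-1\<rangle>\<close>. The factor then occurs squared, which is twice the
  factor, and 2 cancels.\<close>

lemma sq_minus_one_fixes_loc2:
  fixes a :: "'a::field rp"
  assumes "lambda1 a \<in> aug_ideal_plus"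
  shows "rp_to_rpbar (\<langle>-1\<rangle> *\<^sub>R\<^sub>P a) \<otimes>\<^sub>\<int> q = rp_to_rpbar a \<otimes>\<^sub>\<int> (q :: zhalf)"
proof -
  obtain r where "lambda1 a = (1 + \<langle>-1\<rangle>) * r" using assms by (auto simp: aug_ideal_plus_def)
  then have "lambda1 ((1 - \<langle>-1\<rangle>) *\<^sub>R\<^sub>P a) = (1 - \<langle>-1\<rangle>) * ((1 + \<langle>-1\<rangle>) * r)"
    by (simp only: lambda1_scale)
  then have "lambda1 ((1 - \<langle>-1\<rangle>) *\<^sub>R\<^sub>P a) = 0"
    by (simp add: distrib_left distrib_right left_diff_distrib mult.assoc[symmetric])
  then have zero: "rp_to_rpbar ((1 - \<langle>-1\<rangle>) *\<^sub>R\<^sub>P (1 - \<langle>-1\<rangle>) *\<^sub>R\<^sub>P a) \<otimes>\<^sub>\<int> 1 = (0 :: 'a rpbar loc2)"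
    by (rule minus_part_eq_0)
  have square: "(1 - \<langle>-1 :: 'a\<rangle>) * (1 - \<langle>-1\<rangle>) = (1 - \<langle>-1\<rangle>) + (1 - \<langle>-1\<rangle>)"
    by (simp add: algebra_simps)
  from zero have "rp_to_rpbar ((1 - \<langle>-1\<rangle>) *\<^sub>R\<^sub>P a) \<otimes>\<^sub>\<int> 1
      + rp_to_rpbar ((1 - \<langle>-1\<rangle>) *\<^sub>R\<^sub>P a) \<otimes>\<^sub>\<int> 1 = (0 :: 'a rpbar loc2)"
    by (simp only: rp.scale_scale square rp.scale_left_distrib rp_to_rpbar.add tens_add_left)
  then have "rp_to_rpbar ((1 - \<langle>-1\<rangle>) *\<^sub>R\<^sub>P a) \<otimes>\<^sub>\<int> 1 = (0 :: 'a rpbar loc2)"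
    by (rule loc2_double_eq_0)
  \<comment> \<open>Carries the vanishing from the second factor 1 over to \<open>q\<close>.\<close>
  then have "tensor_act rpbar_scale (1 \<otimes>\<^sub>\<int> q) (rp_to_rpbar ((1 - \<langle>-1\<rangle>) *\<^sub>R\<^sub>P a) \<otimes>\<^sub>\<int> 1)
      = tensor_act rpbar_scale (1 \<otimes>\<^sub>\<int> q) (0 :: 'a rpbar loc2)" by simp
  moreover have "tensor_act rpbar_scale (1 \<otimes>\<^sub>\<int> q) (0 :: 'a rpbar loc2) = 0"
    using rpbar.tensor_act_add_right[of "1 \<otimes>\<^sub>\<int> q" 0 "0 :: 'a rpbar loc2"] by simp
  ultimately have "rp_to_rpbar (a - \<langle>-1\<rangle> *\<^sub>R\<^sub>P a) \<otimes>\<^sub>\<int> q = 0"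
    by (simp add: rpbar.tensor_act_tens rp.scale_left_diff_distrib)
  then show ?thesis
    using additive.diff[OF rp_to_rpbar_tens_additive[of q], of a] by simp
qed

section \<open>The two inclusions\<close>

lemma aug_ideal_sq_subset: "aug_ideal_sq \<subseteq> (aug_ideal :: 'a::field sqring set)"
  unfolding aug_ideal_sq_def
  by (rule module.span_minimal[OF ring_self _ subspace_aug_ideal])
    (auto intro: module.subspace_scale[OF ring_self subspace_aug_ideal])

theorem theorem4p3:
  shows "range (rpbar1_loc2_map :: 'a::field rpbar1 loc2 \<Rightarrow> 'a rpbar loc2) =
    range (tensor_act rpbar_scale (e_plus :: 'a sqring loc2))"
proof -
  have map: "rpbar1_loc2_map (a \<otimes>\<^sub>\<int> q) = rpbar1_incl a \<otimes>\<^sub>\<int> q" for a :: "'a rpbar1" and q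
    unfolding rpbar1_loc2_map_def
    by (rule tensor_map_tens[OF additive_rpbar1_incl]) (standard, simp)
  have act: "tensor_act rpbar_scale e_plus (rp_to_rpbar a \<otimes>\<^sub>\<int> q)
      = rp_to_rpbar ((1 + \<langle>-1\<rangle>) *\<^sub>R\<^sub>P a) \<otimes>\<^sub>\<int> (half * q)" for a :: "'a rp" and q
    by (simp add: e_plus_def rpbar.tensor_act_tens rp_to_rpbar.scale)
  show ?thesis
  proof (intro subset_antisym subsetI)
    fix u :: "'a rpbar loc2" assume "u \<in> range rpbar1_loc2_map"
    then obtain t where "u = rpbar1_loc2_map t" by blast
    moreover obtain c k where "t = c \<otimes>\<^sub>\<int> half ^ k" by (rule loc2_cases)
    moreover obtain a where a: "rpbar1_incl c = rp_to_rpbar a" "lambda1 a \<in> aug_ideal_plus"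
      using range_rpbar1_incl by blast
    ultimately have u: "u = rp_to_rpbar a \<otimes>\<^sub>\<int> half ^ k" by (simp add: map)
    \<comment> \<open>As \<open>\<langle>-1\<rangle>\<close> fixes \<open>u\<close>, the idempotent
      fixes it and \<open>u\<close> is its own preimage.\<close>
    have "tensor_act rpbar_scale e_plus u = rp_to_rpbar a \<otimes>\<^sub>\<int> (half * half ^ k)
        + rp_to_rpbar a \<otimes>\<^sub>\<int> (half * half ^ k)"
      unfolding u act
      by (simp add: rp.scale_left_distrib rp_to_rpbar.add tens_add_left
          sq_minus_one_fixes_loc2[OF a(2)])
    also have "\<dots> = rp_to_rpbar a \<otimes>\<^sub>\<int> (half * half ^ k + half * half ^ k)"
      by (rule tens_add_right[symmetric])
    also have "\<dots> = u" by (simp only: u distrib_right[symmetric] half_add_half mult_1)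
    finally show "u \<in> range (tensor_act rpbar_scale e_plus)" by (metis rangeI)
  next
    fix u :: "'a rpbar loc2" assume "u \<in> range (tensor_act rpbar_scale e_plus)"
    then obtain t where "u = tensor_act rpbar_scale e_plus t" by blast
    moreover obtain c k where "t = c \<otimes>\<^sub>\<int> half ^ k" by (rule loc2_cases)
    moreover obtain a where "c = rp_to_rpbar a" by (rule rp_to_rpbar_surj)
    ultimately have u: "u = rp_to_rpbar ((1 + \<langle>-1\<rangle>) *\<^sub>R\<^sub>P a) \<otimes>\<^sub>\<int> (half * half ^ k)"
      by (simp add: act)
    \<comment> \<open>\<open>lambda1 a\<close> lies in the square of the augmentation ideal, hence
      in the ideal itself, and \<open>1 + \<langle>-1\<rangle>\<close> moves it into
      \<open>aug_ideal_plus\<close>.\<close>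
    have "lambda1 ((1 + \<langle>-1\<rangle>) *\<^sub>R\<^sub>P a) \<in> aug_ideal_plus"
      using lambda1_in_aug_ideal_sq[of a] aug_ideal_sq_subset
      by (auto simp: lambda1_scale aug_ideal_plus_def)
    then obtain d where "rp_to_rpbar ((1 + \<langle>-1\<rangle>) *\<^sub>R\<^sub>P a) = rpbar1_incl d"
      using range_rpbar1_incl by blast
    then show "u \<in> range rpbar1_loc2_map" unfolding u by (metis map rangeI)
  qed
qed

end
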